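(* Let $q$ be a prime power, let $m\neq q+1$ be a positive divisor of $q+1$, let $d>0$ be an integer, and let $\mathcal{C}(d)$ be the complete code on the curve $Y: y^q+y=x^m$ over $\mathbb{F}_{q^2}$. Assume $d \le m-2$ and $c=(q+1)/m\ge 3$. Then: 1. The minimum distance of $\mathcal{C}(d)^\perp$ is $d+2$. 2. A set $S\subseteq C(\mathbb{F}_{q^2})\setminus \{Q_\infty\}$ is the support of a minimum-weight codeword of $\mathcal{C}(d)^\perp$ if and only if $\pi(S)$ consists of $d+2$ points lying on a horizontal line. 3. The number of the minimum-weight codewords of $\mathcal{C}(d)^\perp$ is $$(q-1)(q^2-1)\binom{m}{d+2}.$$
   Context: $\mathbb{P}^2$ is the projective plane over $\mathbb{F}_{q^2}$ with homogeneous coordinates $(x:y:z)$. $Y\subseteq\mathbb{P}^2$ is the (projective closure of the) curve with affine equation $y^q+y=x^m$ (affine chart $z=1$); its only point at infinity is $P_\infty=(1:0:0)$. $\pi:C\to Y$ is the normalization, which is injective, and $Q_\infty\in C$ is the point with $\pi(Q_\infty)=P_\infty$. The complete code $\mathcal{C}(d)$ is the linear code over $\mathbb{F}_{q^2}$ obtained by evaluating the vector space $H^0(C,\pi^*(\mathcal{O}_Y(d)))$ at the points of $\pi^{-1}(B)$, where $B=Y(\mathbb{F}_{q^2})\setminus\{P_\infty\}$. Coordinates of codewords (hence supports) are indexed by the points of $\pi^{-1}(B)=C(\mathbb{F}_{q^2})\setminus\{Q_\infty\}$. One has $H^0(C,\pi^*(\mathcal{O}_Y(1)))=L(qQ_\infty)$,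 the identification being division by $z$. $\mathcal{C}(d)^\perp$ is the dual code. A line of $\mathbb{P}^2$ is horizontal if it has an equation of the form $y=a$ for some $a\in\mathbb{F}_{q^2}$ (the line at infinity $z=0$ is not considered horizontal).
   Formalization: In part 3 the number of minimum-weight codewords is corrected to q(q-1)(q^2-1)binom(m,d+2); the printed formula lacks the factor q and is false (for q=8, m=3, d=1 the count is 3528, not 441), since q^2-q horizontal lines contain m points. *)

theory Defs
  imports "HOL-Library.Cardinality" "HOL-Number_Theory.Number_Theory"
    "HOL-Computational_Algebra.Computational_Algebra"
begin

section \<open>Function field of a plane curve\<close>

text \<open>Bivariate polynomials are univariate polynomials in \<open>y\<close> with coefficients in \<open>k[x]\<close>.
  The map \<open>\<iota>\<close> embeds the ground field \<open>k\<close> into a field containing the point \<open>(X, Y)\<close>.\<close>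

definition eval2 :: "('k::field \<Rightarrow> 'f::field) \<Rightarrow> 'f \<Rightarrow> 'f \<Rightarrow> 'k poly poly \<Rightarrow> 'f" where
  "eval2 \<iota> X Y p = poly (map_poly (\<lambda>c. poly (map_poly \<iota> c) X) p) Y"

definition field_embedding :: "('k::field \<Rightarrow> 'f::field) \<Rightarrow> bool" where
  "field_embedding \<iota> \<longleftrightarrow>
     \<iota> 1 = 1 \<and> (\<forall>a b. \<iota> (a + b) = \<iota> a + \<iota> b) \<and> (\<forall>a b. \<iota> (a * b) = \<iota> a * \<iota> b)"

text \<open>The type \<open>'f\<close> is the fraction field of \<open>k[x,y]/(g)\<close>, where \<open>X\<close> and \<open>Y\<close> are the
  classes of \<open>x\<close> and \<open>y\<close>.\<close>

definition is_function_field ::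
  "'k::field poly poly \<Rightarrow> ('k \<Rightarrow> 'f::field) \<Rightarrow> 'f \<Rightarrow> 'f \<Rightarrow> bool" where
  "is_function_field g \<iota> X Y \<longleftrightarrow>
     field_embedding \<iota> \<and>
     (\<forall>p. eval2 \<iota> X Y p = 0 \<longleftrightarrow> g dvd p) \<and>
     (\<forall>f. \<exists>p r. eval2 \<iota> X Y r \<noteq> 0 \<and> f = eval2 \<iota> X Y p / eval2 \<iota> X Y r)"

text \<open>The polynomial \<open>y^q + y - x^m\<close>.\<close>

definition curve_poly :: "nat \<Rightarrow> nat \<Rightarrow> 'k::field poly poly" where
  "curve_poly q m = monom 1 q + monom 1 1 - [:monom 1 m:]"


section \<open>Points of the normalization\<close>

text \<open>The closed points of the normalization \<open>C\<close> of the projective closure of the curve are the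
  places of its function field, each given by its valuation ring \<open>P\<close> (the local ring of \<open>C\<close> at
  that point).\<close>

definition place :: "('k::field \<Rightarrow> 'f::field) \<Rightarrow> 'f set \<Rightarrow> bool" where
  "place \<iota> P \<longleftrightarrow>
     range \<iota> \<subseteq> P \<and> (\<forall>f\<in>P. \<forall>g\<in>P. f - g \<in> P \<and> f * g \<in> P) \<and>
     P \<noteq> UNIV \<and> (\<forall>f. f \<in> P \<or> inverse f \<in> P)"

definition max_ideal :: "'f::field set \<Rightarrow> 'f set" where
  "max_ideal P = {f \<in> P. f = 0 \<or> inverse f \<notin> P}"

text \<open>The \<open>k\<close>-rational points are the places whose residue field is \<open>k\<close>.\<close>

definition rational_points :: "('k::field \<Rightarrow> 'f::field) \<Rightarrow> 'f set set" where
  "rational_points \<iota> = {P. place \<iota> P \<and> (\<forall>f\<in>P. \<exists>a. f - \<iota> a \<in> max_ideal P)}"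

text \<open>The value at a rational point \<open>P\<close> of a function \<open>f \<in> P\<close>, that is, regular at that point.\<close>

definition value_at :: "('k::field \<Rightarrow> 'f::field) \<Rightarrow> 'f set \<Rightarrow> 'f \<Rightarrow> 'k" where
  "value_at \<iota> P f = (THE a. f - \<iota> a \<in> max_ideal P)"

text \<open>A scaling factor \<open>u\<close> makes \<open>(uX : uY : u)\<close> homogeneous coordinates of \<open>(X : Y : 1)\<close> that
  are regular at \<open>P\<close> and do not all vanish there. Equivalently, \<open>1/u\<close> generates the
  \<open>P\<close>-module spanned by \<open>X\<close>, \<open>Y\<close>, \<open>1\<close>.\<close>

definition coord_scale :: "'f::field \<Rightarrow> 'f \<Rightarrow> 'f set \<Rightarrow> 'f \<Rightarrow> bool" where
  "coord_scale X Y P u \<longleftrightarrow> {u * X, u * Y, u} \<subseteq> P \<and> \<not> {u * X, u * Y, u} \<subseteq> max_ideal P"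


section \<open>The projective plane and the normalization map\<close>

text \<open>A point of the projective plane is the set of all its homogeneous coordinate vectors.\<close>

definition proj_point :: "'k::field \<Rightarrow> 'k \<Rightarrow> 'k \<Rightarrow> ('k \<times> 'k \<times> 'k) set" where
  "proj_point a b c = {(s * a, s * b, s * c) | s. s \<noteq> 0}"

definition horizontal_line :: "'k::field \<Rightarrow> ('k \<times> 'k \<times> 'k) set set" where
  "horizontal_line a = {proj_point x y z | x y z. (x, y, z) \<noteq> (0, 0, 0) \<and> y = a * z}"

text \<open>The image in the plane of a rational point of \<open>C\<close>. As \<open>u\<close> ranges over the scaling factors,
  one obtains all the homogeneous coordinate vectors of the image.\<close>

definition normalization_map ::
  "('k::field \<Rightarrow> 'f::field) \<Rightarrow> 'f \<Rightarrow> 'f \<Rightarrow> 'f set \<Rightarrow> ('k \<times> 'k \<times> 'k) set" where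
  "normalization_map \<iota> X Y P =
     {(value_at \<iota> P (u * X), value_at \<iota> P (u * Y), value_at \<iota> P u) | u. coord_scale X Y P u}"

definition Q_infty :: "('k::field \<Rightarrow> 'f::field) \<Rightarrow> 'f \<Rightarrow> 'f \<Rightarrow> 'f set" where
  "Q_infty \<iota> X Y = (THE Q. Q \<in> rational_points \<iota> \<and> normalization_map \<iota> X Y Q = proj_point 1 0 0)"

definition eval_points :: "('k::field \<Rightarrow> 'f::field) \<Rightarrow> 'f \<Rightarrow> 'f \<Rightarrow> 'f set set" where
  "eval_points \<iota> X Y = rational_points \<iota> - {Q_infty \<iota> X Y}"


section \<open>Codes\<close>

text \<open>The global sections of the pull-back to \<open>C\<close> of \<open>O(d)\<close>, each divided by \<open>z^d\<close>. After this
  division the stalk at a point \<open>P\<close> is the \<open>P\<close>-submodule of the function field generated by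
  \<open>(1/u)^d\<close>, for any scaling factor \<open>u\<close> at \<open>P\<close>.\<close>

definition global_sections ::
  "('k::field \<Rightarrow> 'f::field) \<Rightarrow> 'f \<Rightarrow> 'f \<Rightarrow> nat \<Rightarrow> 'f set" where
  "global_sections \<iota> X Y d =
     {f. \<forall>P. place \<iota> P \<longrightarrow> (\<exists>u. coord_scale X Y P u \<and> f * u ^ d \<in> P)}"

text \<open>Words over an index set \<open>I\<close> are functions that vanish outside \<open>I\<close>.\<close>

definition complete_code ::
  "('k::field \<Rightarrow> 'f::field) \<Rightarrow> 'f \<Rightarrow> 'f \<Rightarrow> nat \<Rightarrow> ('f set \<Rightarrow> 'k) set" where
  "complete_code \<iota> X Y d =
     (\<lambda>f P. if P \<in> eval_points \<iota> X Y then value_at \<iota> P f else 0) ` global_sections \<iota> X Y d"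

definition dual_code :: "'i set \<Rightarrow> ('i \<Rightarrow> 'k::field) set \<Rightarrow> ('i \<Rightarrow> 'k) set" where
  "dual_code I A =
     {w. (\<forall>i. i \<notin> I \<longrightarrow> w i = 0) \<and> (\<forall>v\<in>A. (\<Sum>i\<in>I. v i * w i) = 0)}"

definition support :: "('i \<Rightarrow> 'k::zero) \<Rightarrow> 'i set" where
  "support w = {i. w i \<noteq> 0}"

definition hamming_distance :: "('i \<Rightarrow> 'k) \<Rightarrow> ('i \<Rightarrow> 'k) \<Rightarrow> nat" where
  "hamming_distance v w = card {i. v i \<noteq> w i}"

definition minimum_distance :: "('i \<Rightarrow> 'k) set \<Rightarrow> nat" where
  "minimum_distance A = Inf {hamming_distance v w | v w. v \<in> A \<and> w \<in> A \<and> v \<noteq> w}"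

definition minimum_weight_codewords :: "('i \<Rightarrow> 'k::zero) set \<Rightarrow> ('i \<Rightarrow> 'k) set" where
  "minimum_weight_codewords A =
     {w \<in> A. w \<noteq> (\<lambda>_. 0) \<and>
       (\<forall>v\<in>A. v \<noteq> (\<lambda>_. 0) \<longrightarrow> card (support w) \<le> card (support v))}"

end

theory Submission
  imports Defs
begin

text \<open>The curve has one point at infinity, at which \<open>X\<close> and \<open>Y\<close> have pole orders \<open>q\<close> and \<open>m\<close>; the
  global sections are the polynomials in \<open>X\<close> and \<open>Y\<close> of pole order at most \<open>dq\<close> there. On a
  horizontal line they restrict to polynomials in \<open>x\<close> of degree at most \<open>d\<close>, so that the weights of a
  divided difference of order \<open>d + 1\<close> give a codeword of the dual code supported on any \<open>d + 2\<close> points of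
  the line. Conversely, products of linear factors \<open>X - a\<close>, \<open>Y - b\<close> and, as \<open>2m \<le> q\<close>, of quadratic
  factors \<open>(Y - b)(Y - b')\<close> separate the points of every other support of size at most \<open>d + 2\<close>.

  The sections are identified without the theory of curves. Every element of the function field is a
  power of \<open>X - a\<close> times a unit at the point \<open>(a, b)\<close>, by a norm argument, and a power of \<open>X/Y\<^sup>c\<close>
  times a unit at infinity; so there is exactly one place over each of these points. A function without
  finite poles is integral over \<open>k[X, Y]\<close>, by the extension theorem for places, and \<open>k[X, Y]\<close> is
  integrally closed because the Frobenius map is injective modulo each irreducible polynomial in \<open>X\<close>.\<close>

section \<open>Valuation rings\<close>

text \<open>Horizontal lines are special because of the pole orders. A section of degree
  \<open>d\<close> consists of monomials \<open>X^i Y^j\<close> with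
  \<open>qi + mj \<le> qd\<close>. Its degree in \<open>X\<close> is at most \<open>d\<close>, but
  the degree in \<open>Y\<close> may be larger: on a line \<open>x = a\<close> there are enough
  sections to separate any \<open>d + 2\<close> points. From \<open>c \<ge> 3\<close> one gets
  \<open>3m \<le> q + 1\<close> and so \<open>2m \<le> q\<close>; for \<open>c = 2\<close> one would
  have \<open>2m = q + 1\<close>.

  The points on \<open>y = b\<close> are given by \<open>x^m = b^q + b\<close>. The right-hand side
  lies in the subfield with \<open>q\<close> elements, whose nonzero elements have exactly
  \<open>m\<close> roots of this kind since \<open>m\<close> divides \<open>q + 1\<close>. It
  vanishes for \<open>q\<close> values of \<open>b\<close>, and these lines carry one point each.
  The other \<open>q^2 - q\<close> lines carry \<open>m\<close> points, whence the factor
  \<open>q(q - 1)\<close>, rather than \<open>q - 1\<close>, in the number of codewords. The factor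
  \<open>q^2 - 1\<close> counts scalars, as a support determines its codeword up to a scalar.

  A place is only a subring here, without a valuation. The order of a function is therefore
  expressed by an equation \<open>f * \<pi>^a = u * \<pi>^b\<close> in which \<open>u\<close> is a
  unit.\<close>

definition subring_of :: "'a::field set \<Rightarrow> bool" where
  "subring_of R \<longleftrightarrow> 1 \<in> R \<and> (\<forall>x\<in>R. \<forall>y\<in>R. x - y \<in> R \<and> x * y \<in> R)"

lemma subring_ofD:
  assumes "subring_of R"
  shows "1 \<in> R" "0 \<in> R" "x \<in> R \<Longrightarrow> y \<in> R \<Longrightarrow> x - y \<in> R" "x \<in> R \<Longrightarrow> y \<in> R \<Longrightarrow> x * y \<in> R"
    "x \<in> R \<Longrightarrow> - x \<in> R" "x \<in> R \<Longrightarrow> y \<in> R \<Longrightarrow> x + y \<in> R" "x \<in> R \<Longrightarrow> x ^ n \<in> R"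
proof -
  show 1: "1 \<in> R" and d: "x \<in> R \<Longrightarrow> y \<in> R \<Longrightarrow> x - y \<in> R" and
    m: "x \<in> R \<Longrightarrow> y \<in> R \<Longrightarrow> x * y \<in> R" for x y
    using assms by (auto simp: subring_of_def)
  show 0: "0 \<in> R" using d[OF 1 1] by simp
  show n: "x \<in> R \<Longrightarrow> - x \<in> R" for x using d[OF 0, of x] by simp
  show "x \<in> R \<Longrightarrow> y \<in> R \<Longrightarrow> x + y \<in> R" for x y using d[of x "- y"] n by simp
  show "x \<in> R \<Longrightarrow> x ^ n \<in> R" by (induction n) (auto intro: 1 m)
qed

lemma subring_of_sum:
  assumes "subring_of R" "\<And>i. i \<in> I \<Longrightarrow> f i \<in> R"
  shows "sum f I \<in> R"
  using assms(2) by (induction I rule: infinite_finite_induct) (auto intro: subring_ofD[OF assms(1)])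

definition adjoin :: "'a::field set \<Rightarrow> 'a \<Rightarrow> 'a set" where
  "adjoin R z = {poly p z | p. \<forall>i. coeff p i \<in> R}"

lemma subring_of_adjoin:
  assumes R: "subring_of R"
  shows "subring_of (adjoin R z)" "R \<subseteq> adjoin R z" "z \<in> adjoin R z"
proof -
  note D = subring_ofD[OF R]
  have 1: "1 \<in> adjoin R z"
    unfolding adjoin_def by (rule CollectI, rule exI[of _ 1]) (auto simp: coeff_1 D)
  show "subring_of (adjoin R z)"
    unfolding subring_of_def
  proof (intro conjI ballI 1)
    fix x y assume "x \<in> adjoin R z" "y \<in> adjoin R z"
    then obtain p r where p: "x = poly p z" "\<And>i. coeff p i \<in> R"
      and r: "y = poly r z" "\<And>i. coeff r i \<in> R" by (auto simp: adjoin_def)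
    show "x - y \<in> adjoin R z"
      unfolding adjoin_def by (rule CollectI, rule exI[of _ "p - r"]) (auto simp: p r D)
    show "x * y \<in> adjoin R z"
      unfolding adjoin_def
      by (rule CollectI, rule exI[of _ "p * r"]) (auto simp: p r coeff_mult intro!: D subring_of_sum[OF R])
  qed
  show "R \<subseteq> adjoin R z"
  proof
    fix x assume "x \<in> R"
    then show "x \<in> adjoin R z"
      unfolding adjoin_def by (intro CollectI exI[of _ "[:x:]"]) (auto simp: coeff_pCons D split: nat.split)
  qed
  show "z \<in> adjoin R z"
    unfolding adjoin_def by (intro CollectI exI[of _ "[:0, 1:]"]) (auto simp: coeff_pCons D split: nat.split)
qed

lemma adjoin_sum:
  assumes "f \<in> adjoin R z" "subring_of R"
  obtains n a where "\<And>i. a i \<in> R" "f = (\<Sum>i\<le>n. a i * z ^ i)"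
  using assms by (auto simp: adjoin_def poly_altdef)

text \<open>A subring that is maximal among those not containing \<open>1/t\<close> is a valuation ring: otherwise
  \<open>1\<close> is a polynomial in \<open>z\<close> and also a polynomial in \<open>1/z\<close>, both with coefficients in \<open>tR\<close>, and the
  one of higher degree can be reduced by the other.\<close>

lemma unit_relation_descent:
  assumes R: "subring_of R" and t: "t \<in> R" and z: "z \<noteq> 0"
    and inv: "\<And>b. b \<in> R \<Longrightarrow> inverse (1 - t * b) \<in> R \<and> 1 - t * b \<noteq> 0"
    and a: "\<And>i. a i \<in> R" "1 = (\<Sum>i\<le>n. t * a i * z ^ i)"
    and b: "\<And>i. b i \<in> R" "1 = (\<Sum>i\<le>k. t * b i * inverse z ^ i)"
  shows False
  using z a b
proof (induction "n + k" arbitrary: n k z a b rule: less_induct)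
  case less
  note D = subring_ofD[OF R]
  \<comment> \<open>The claim is symmetric under exchanging \<open>z\<close> with its inverse
    together with the two relations, so it suffices to shorten the relation that is at least as long
    as the other.\<close>
  have step: False
    if "k' \<le> n'" "n' + k' = n + k" "z' \<noteq> 0" and a': "\<And>i. a' i \<in> R" "1 = (\<Sum>i\<le>n'. t * a' i * z' ^ i)"
      and b': "\<And>i. b' i \<in> R" "1 = (\<Sum>i\<le>k'. t * b' i * inverse z' ^ i)" for n' k' z' a' b'
  proof (cases n')
    case 0
    then have "1 - t * a' 0 = 0" using a' by simp
    then show False using inv[OF a'(1)] by blast
  next
    case (Suc l)
    \<comment> \<open>Moving the constant term of the second relation to the left forms the unit
      \<open>w\<close>. Multiplied by \<open>z'^n'\<close>, the relation expresses
      \<open>z'^n'\<close> by lower powers with coefficients in \<open>tR\<close>, and substituting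
      this removes the top term of the first relation. Below, \<open>v\<close> pads
      \<open>b'\<close> with zeros up to index \<open>n'\<close>.\<close>
    define w where "w = 1 - t * b' 0"
    have w: "inverse w \<in> R" "w \<noteq> 0" using inv[OF b'(1)] unfolding w_def by blast+
    define v where "v i = (if i \<le> k' then b' i else 0)" for i
    have "1 = (\<Sum>i\<le>n'. t * v i * inverse z' ^ i)"
      unfolding b'(2) by (rule sum.mono_neutral_cong_left) (use \<open>k' \<le> n'\<close> in \<open>auto simp: v_def\<close>)
    also have "\<dots> = t * v 0 + (\<Sum>i\<in>{1..n'}. t * v i * inverse z' ^ i)"
      unfolding atMost_atLeast0 by (subst sum.atLeast_Suc_atMost) auto
    finally have w_eq: "w = (\<Sum>i\<in>{1..n'}. t * v i * inverse z' ^ i)"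
      by (simp add: w_def v_def algebra_simps)
    have "w * z' ^ n' = (\<Sum>i\<in>{1..n'}. t * v i * z' ^ (n' - i))"
      unfolding w_eq sum_distrib_right
    proof (rule sum.cong[OF refl], goal_cases)
      case (1 i)
      then have "z' ^ n' = z' ^ (n' - i) * z' ^ i" by (simp flip: power_add)
      then show ?case using \<open>z' \<noteq> 0\<close> by (simp add: power_inverse)
    qed
    also have "\<dots> = (\<Sum>i\<le>l. t * v (n' - i) * z' ^ i)"
      by (rule sum.reindex_bij_witness[of _ "\<lambda>i. n' - i" "\<lambda>i. n' - i"]) (auto simp: Suc)
    finally have "inverse w * (w * z' ^ n') = inverse w * (\<Sum>i\<le>l. t * v (n' - i) * z' ^ i)"
      by simp
    then have z_eq: "z' ^ n' = (\<Sum>i\<le>l. t * (inverse w * v (n' - i)) * z' ^ i)"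
      unfolding sum_distrib_left mult.assoc[symmetric]
      using w(2) by (simp add: mult_ac)
    define e where "e i = a' i + t * a' n' * (inverse w * v (n' - i))" for i
    have e: "e i \<in> R" for i
      using a'(1) w t b'(1) unfolding e_def v_def by (auto intro!: D)
    have "1 = (\<Sum>i\<le>l. t * a' i * z' ^ i) + t * a' n' * z' ^ n'"
      using a'(2) by (simp add: Suc)
    also have "\<dots> = (\<Sum>i\<le>l. t * e i * z' ^ i)"
      unfolding z_eq e_def sum_distrib_left sum.distrib[symmetric]
      by (intro sum.cong refl) (simp add: algebra_simps)
    finally show False
      using less.hyps[of l k' z' e b'] that Suc e by simp
  qed
  show False
  proof (cases "k \<le> n")
    case True
    then show False using step[of k n z a b] less.prems by simp
  next
    case False
    then show False using step[of n k "inverse z" b a] less.prems by simp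
  qed
qed

lemma ex_valuation_ring:
  assumes A: "subring_of A" and t: "t \<in> A" "inverse t \<notin> A"
  obtains P where "subring_of P" "A \<subseteq> P" "inverse t \<notin> P" "\<And>z. z \<in> P \<or> inverse z \<in> P"
proof -
  define \<F> where "\<F> = {R. subring_of R \<and> A \<subseteq> R \<and> inverse t \<notin> R}"
  have "\<exists>M\<in>\<F>. \<forall>R\<in>\<F>. M \<subseteq> R \<longrightarrow> R = M"
  proof (rule subset_Zorn_nonempty)
    show "\<F> \<noteq> {}" using A t by (auto simp: \<F>_def)
    fix C assume C: "C \<noteq> {}" "subset.chain \<F> C"
    have "\<exists>R\<in>C. x \<in> R \<and> y \<in> R" if "x \<in> \<Union>C" "y \<in> \<Union>C" for x y
    proof -
      obtain R S where "R \<in> C" "S \<in> C" "x \<in> R" "y \<in> S" using \<open>x \<in> \<Union>C\<close> \<open>y \<in> \<Union>C\<close> by blast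
      moreover have "R \<subseteq> S \<or> S \<subseteq> R"
        using C(2) \<open>R \<in> C\<close> \<open>S \<in> C\<close> by (auto simp: subset.chain_def)
      ultimately show ?thesis by blast
    qed
    moreover have "subring_of R" if "R \<in> C" for R
      using that C(2) by (auto simp: \<F>_def subset.chain_def)
    ultimately have "x - y \<in> \<Union>C \<and> x * y \<in> \<Union>C" if "x \<in> \<Union>C" "y \<in> \<Union>C" for x y
      using that by (meson UnionI subring_ofD(3,4))
    moreover have "1 \<in> \<Union>C"
      using C subring_ofD(1) by (force simp: \<F>_def subset.chain_def)
    ultimately have "subring_of (\<Union>C)"
      unfolding subring_of_def by blast
    moreover have "A \<subseteq> R" "inverse t \<notin> R" if "R \<in> C" for R
      using that C(2) by (auto simp: \<F>_def subset.chain_def)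
    then have "A \<subseteq> \<Union>C" "inverse t \<notin> \<Union>C"
      using C(1) by blast+
    ultimately show "\<Union>C \<in> \<F>" by (simp add: \<F>_def)
  qed
  then obtain R where "R \<in> \<F>" and R_max: "\<And>S. S \<in> \<F> \<Longrightarrow> R \<subseteq> S \<Longrightarrow> S = R" by blast
  then have R: "subring_of R" "A \<subseteq> R" "inverse t \<notin> R" by (auto simp: \<F>_def)
  have max: "S = R" if "subring_of S" "R \<subseteq> S" "inverse t \<notin> S" for S
    using R_max[of S] that R by (auto simp: \<F>_def)
  note D = subring_ofD[OF R(1)]
  have tR: "t \<in> R" using R t by blast
  have t0: "t \<noteq> 0" using R(3) D(2) by auto
  \<comment> \<open>This follows from maximality. With \<open>w = 1 - t * b\<close>, every element
    of \<open>R[1/w]\<close> is carried into \<open>R\<close> by a power of \<open>w\<close>, and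
    all powers of \<open>w\<close> are 1 modulo \<open>tR\<close>. If \<open>R[1/w]\<close>
    contained \<open>inverse t\<close>, so would \<open>R\<close>; hence adjoining
    \<open>1/w\<close> adds nothing.\<close>
  have unit: "inverse (1 - t * b) \<in> R \<and> 1 - t * b \<noteq> 0" if b: "b \<in> R" for b
  proof -
    define w where "w = 1 - t * b"
    have w0: "w \<noteq> 0"
    proof
      assume "w = 0"
      then have "inverse t = b" using t0 by (simp add: w_def field_simps)
      then show False using R b by simp
    qed
    have pow: "\<exists>s\<in>R. w ^ k = 1 - t * s" for k
    proof (induction k)
      case 0
      show ?case using D(2) by (intro bexI[of _ 0]) auto
    next
      case (Suc k)
      then obtain s where "s \<in> R" "w ^ k = 1 - t * s" by blast
      moreover have "w ^ Suc k = 1 - t * (b + s - t * b * s)"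
        by (simp add: \<open>w ^ k = 1 - t * s\<close>) (simp add: w_def algebra_simps)
      moreover have "b + s - t * b * s \<in> R" by (intro D b tR \<open>s \<in> R\<close>)
      ultimately show ?case by blast
    qed
    have w: "w \<in> R" unfolding w_def by (intro D b tR)
    have den: "\<exists>k. x * w ^ k \<in> R" if x: "x \<in> adjoin R (inverse w)" for x
    proof -
      obtain n a where a: "\<And>i. a i \<in> R" "x = (\<Sum>i\<le>n. a i * inverse w ^ i)"
        using adjoin_sum[OF x R(1)] by metis
      have "x * w ^ n = (\<Sum>i\<le>n. a i * w ^ (n - i))"
        unfolding a(2) sum_distrib_right
      proof (rule sum.cong[OF refl], goal_cases)
        case (1 i)
        then have "w ^ n = w ^ (n - i) * w ^ i" by (simp flip: power_add)
        then show ?case using w0 by (simp add: power_inverse)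
      qed
      also have "\<dots> \<in> R" by (intro subring_of_sum[OF R(1)] D a w)
      finally show ?thesis ..
    qed
    have "inverse t \<notin> adjoin R (inverse w)"
    proof
      assume "inverse t \<in> adjoin R (inverse w)"
      then obtain k where k: "inverse t * w ^ k \<in> R" using den by blast
      obtain s where s: "s \<in> R" "w ^ k = 1 - t * s" using pow by blast
      have "inverse t = inverse t * w ^ k + s" using t0 by (simp add: s field_simps)
      moreover have "inverse t * w ^ k + s \<in> R" by (intro D k s)
      ultimately show False using R by simp
    qed
    then have "adjoin R (inverse w) = R"
      using max subring_of_adjoin[OF R(1)] by blast
    then show ?thesis using subring_of_adjoin(3)[OF R(1), of "inverse w"] w0 by (simp add: w_def)
  qed
  have "z \<in> R \<or> inverse z \<in> R" for z
  proof (rule ccontr)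
    assume z: "\<not> (z \<in> R \<or> inverse z \<in> R)"
    \<comment> \<open>By maximality \<open>R[y]\<close> contains \<open>inverse t\<close>;
      multiplying an expression for it by \<open>t\<close> gives the relation.\<close>
    have rel: "\<exists>a n. (\<forall>i. a i \<in> R) \<and> 1 = (\<Sum>i\<le>n. t * a i * y ^ i)" if "y \<notin> R" for y
    proof -
      have "inverse t \<in> adjoin R y"
        using max[OF subring_of_adjoin(1,2)[OF R(1)], of y] subring_of_adjoin(3)[OF R(1), of y] that
        by blast
      then obtain n a where a: "\<And>i. a i \<in> R" "inverse t = (\<Sum>i\<le>n. a i * y ^ i)"
        using adjoin_sum[OF _ R(1)] by metis
      have "1 = t * inverse t" using t0 by simp
      also have "\<dots> = (\<Sum>i\<le>n. t * a i * y ^ i)" by (simp add: a(2) sum_distrib_left algebra_simps)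
      finally show ?thesis using a(1) by blast
    qed
    have "z \<noteq> 0" using z D(2) by auto
    moreover obtain a n where a: "\<And>i. a i \<in> R" "1 = (\<Sum>i\<le>n. t * a i * z ^ i)"
      using rel z by metis
    moreover obtain b k where b: "\<And>i. b i \<in> R" "1 = (\<Sum>i\<le>k. t * b i * inverse z ^ i)"
      using rel z by metis
    ultimately show False using unit_relation_descent[OF R(1) tR _ unit, of z a n b k] by blast
  qed
  then show ?thesis using that R by blast
qed


section \<open>Places\<close>

lemma placeD:
  assumes "place \<iota> P"
  shows "subring_of P" "\<iota> a \<in> P" "f \<notin> P \<Longrightarrow> inverse f \<in> P"
  using assms unfolding place_def subring_of_def
  by auto

lemma ex_place:
  assumes emb: "field_embedding \<iota>" and A: "subring_of A" "range \<iota> \<subseteq> A"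
    and t: "t \<in> A" "inverse t \<notin> A"
  obtains P where "place \<iota> P" "A \<subseteq> P" "inverse t \<notin> P"
proof -
  obtain P where P: "subring_of P" "A \<subseteq> P" "inverse t \<notin> P" "\<And>z. z \<in> P \<or> inverse z \<in> P"
    using ex_valuation_ring[OF A(1) t] by blast
  then have "place \<iota> P" using A(2) unfolding place_def subring_of_def by blast
  then show ?thesis using that P by blast
qed


section \<open>Maximal ideals and residues at a place\<close>

locale ground_embedding =
  fixes \<iota> :: "'k::field \<Rightarrow> 'f::field"
  assumes emb: "field_embedding \<iota>"
begin

lemma iota_simps [simp]:
  "\<iota> 1 = 1" "\<iota> 0 = 0" "\<iota> (a + b) = \<iota> a + \<iota> b" "\<iota> (a * b) = \<iota> a * \<iota> b"
  "\<iota> (- a) = - \<iota> a" "\<iota> (a - b) = \<iota> a - \<iota> b" "\<iota> (a ^ n) = \<iota> a ^ n"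
proof -
  show 1: "\<iota> 1 = 1" and add: "\<iota> (a + b) = \<iota> a + \<iota> b" and mult: "\<iota> (a * b) = \<iota> a * \<iota> b" for a b
    using emb by (auto simp: field_embedding_def)
  show 0: "\<iota> 0 = 0" using add[of 0 0] by (metis add_cancel_right_left add_0)
  show minus: "\<iota> (- a) = - \<iota> a" for a using add[of a "- a"] 0 by (simp add: minus_unique)
  show "\<iota> (a - b) = \<iota> a - \<iota> b" for a b using add[of a "- b"] minus by simp
  show "\<iota> (a ^ n) = \<iota> a ^ n" by (induction n) (auto simp: 1 mult)
qed

lemma iota_eq_0_iff [simp]: "\<iota> a = 0 \<longleftrightarrow> a = 0"
proof
  assume "\<iota> a = 0"
  then have "\<iota> (a * inverse a) = 0" by (simp del: right_inverse)
  then show "a = 0" by (cases "a = 0") auto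
qed auto

lemma iota_inverse [simp]: "\<iota> (inverse a) = inverse (\<iota> a)"
proof (cases "a = 0")
  case False
  then have "\<iota> a * \<iota> (inverse a) = 1" by (simp flip: iota_simps(4))
  then show ?thesis by (simp add: inverse_unique)
qed auto

context
  fixes P assumes P: "place \<iota> P"
begin

lemma place_subring: "subring_of P"
  using P by (rule placeD)

lemmas place_closed = subring_ofD[OF place_subring]

lemma iota_in_place: "\<iota> a \<in> P"
  using P by (rule placeD)

lemma max_ideal_subset: "f \<in> max_ideal P \<Longrightarrow> f \<in> P"
  by (simp add: max_ideal_def)

lemma zero_in_max_ideal: "0 \<in> max_ideal P"
  using place_closed(2) by (simp add: max_ideal_def)

lemma one_notin_max_ideal: "1 \<notin> max_ideal P"
  using place_closed(1) by (simp add: max_ideal_def)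

lemma inverse_in_max_ideal: "f \<notin> P \<Longrightarrow> inverse f \<in> max_ideal P"
  using placeD(3)[OF P] by (simp add: max_ideal_def)

lemma place_unit:
  assumes "f \<in> P" "f \<notin> max_ideal P"
  shows "inverse f \<in> P" "f \<noteq> 0" "inverse f \<notin> max_ideal P"
  using assms by (auto simp: max_ideal_def)

lemma max_ideal_mult:
  assumes "f \<in> max_ideal P" "g \<in> P"
  shows "f * g \<in> max_ideal P" "g * f \<in> max_ideal P"
proof -
  show *: "f * g \<in> max_ideal P"
  proof (rule ccontr)
    assume "f * g \<notin> max_ideal P"
    then have i: "inverse (f * g) \<in> P" "f * g \<noteq> 0"
      using place_unit[of "f * g"] place_closed(4)[OF max_ideal_subset assms(2)] assms(1) by blast+
    then have "inverse f = g * inverse (f * g)" by (simp add: field_simps)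
    then have "inverse f \<in> P" using place_closed(4)[OF assms(2) i(1)] by metis
    then show False using i assms by (auto simp: max_ideal_def)
  qed
  then show "g * f \<in> max_ideal P" by (simp add: mult.commute)
qed

text \<open>Of two nonzero elements one divides the other in \<open>P\<close>, so the sum is a
  multiple in \<open>P\<close> of one of them.\<close>

lemma max_ideal_add:
  assumes "f \<in> max_ideal P" "g \<in> max_ideal P"
  shows "f + g \<in> max_ideal P"
proof (cases "f = 0 \<or> g = 0")
  case True
  then show ?thesis using assms by auto
next
  case False
  consider "f / g \<in> P" | "g / f \<in> P"
    using placeD(3)[OF P, of "f / g"] by auto
  then show ?thesis
  proof cases
    case 1
    then have "g * (f / g + 1) \<in> max_ideal P"
      by (intro max_ideal_mult assms place_closed)
    then show ?thesis using False by (simp add: algebra_simps)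
  next
    case 2
    then have "f * (g / f + 1) \<in> max_ideal P"
      by (intro max_ideal_mult assms place_closed)
    then show ?thesis using False by (simp add: algebra_simps)
  qed
qed

lemma max_ideal_uminus: "f \<in> max_ideal P \<Longrightarrow> - f \<in> max_ideal P"
  using max_ideal_mult(1)[of f "- 1"] place_closed(5)[OF place_closed(1)] by simp

lemma max_ideal_diff: "f \<in> max_ideal P \<Longrightarrow> g \<in> max_ideal P \<Longrightarrow> f - g \<in> max_ideal P"
  using max_ideal_add[of f "- g"] max_ideal_uminus by simp

lemma max_ideal_sum: "(\<And>i. i \<in> I \<Longrightarrow> f i \<in> max_ideal P) \<Longrightarrow> sum f I \<in> max_ideal P"
  by (induction I rule: infinite_finite_induct) (auto intro: zero_in_max_ideal max_ideal_add)

lemma place_prime: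
  assumes "f \<in> P" "g \<in> P" "f * g \<in> max_ideal P"
  shows "f \<in> max_ideal P \<or> g \<in> max_ideal P"
proof (rule ccontr)
  assume "\<not> ?thesis"
  then have "inverse f \<in> P" "f \<noteq> 0" "g \<notin> max_ideal P" using assms place_unit by blast+
  moreover have "inverse f * (f * g) = g" using \<open>f \<noteq> 0\<close> by simp
  ultimately show False using max_ideal_mult(2)[OF assms(3), of "inverse f"] by metis
qed

lemma power_in_max_idealD: "f \<in> P \<Longrightarrow> f ^ n \<in> max_ideal P \<Longrightarrow> f \<in> max_ideal P"
proof (induction n)
  case (Suc n)
  then show ?case using place_prime[of f "f ^ n"] place_closed(7) by auto
qed (use one_notin_max_ideal in simp)

lemma power_in_max_ideal: "f \<in> max_ideal P \<Longrightarrow> n > 0 \<Longrightarrow> f ^ n \<in> max_ideal P"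
  by (cases n) (auto intro: max_ideal_mult(1) place_closed(7) max_ideal_subset)

text \<open>An instance of the integral closedness of valuation rings: were \<open>f\<close> outside
  \<open>P\<close>, then \<open>inverse f ^ n\<close> would be in the maximal ideal and yet have the
  inverse \<open>f ^ n\<close> in \<open>P\<close>.\<close>

lemma power_in_placeD:
  assumes "f ^ n \<in> P" "n > 0"
  shows "f \<in> P"
proof (rule ccontr)
  assume f: "f \<notin> P"
  then have "inverse f ^ n \<in> max_ideal P"
    using inverse_in_max_ideal power_in_max_ideal assms by blast
  then have "inverse f ^ n * f ^ n \<in> max_ideal P" using max_ideal_mult(1) assms(1) by blast
  moreover have "f \<noteq> 0" using f place_closed(2) by auto
  ultimately show False using one_notin_max_ideal by (simp add: power_inverse)
qed

lemma iota_in_max_ideal_iff: "\<iota> a \<in> max_ideal P \<longleftrightarrow> a = 0"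
  using iota_in_place[of "inverse a"] zero_in_max_ideal
  by (auto simp: max_ideal_def)

lemma residue_unique:
  assumes "f - \<iota> a \<in> max_ideal P" "f - \<iota> b \<in> max_ideal P"
  shows "a = b"
proof -
  have "\<iota> (b - a) \<in> max_ideal P" using max_ideal_diff[OF assms] by simp
  then show ?thesis using iota_in_max_ideal_iff by (metis eq_iff_diff_eq_0)
qed

lemma value_at_eqI: "f - \<iota> a \<in> max_ideal P \<Longrightarrow> value_at \<iota> P f = a"
  unfolding value_at_def by (rule the_equality) (auto intro: residue_unique)

lemma residue_in_place: "f - \<iota> a \<in> max_ideal P \<Longrightarrow> f \<in> P"
  using place_closed(6)[of "f - \<iota> a" "\<iota> a"] max_ideal_subset iota_in_place by simp

lemma residue_mult:
  assumes "f - \<iota> a \<in> max_ideal P" "g - \<iota> b \<in> max_ideal P"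
  shows "f * g - \<iota> (a * b) \<in> max_ideal P"
proof -
  have "(f - \<iota> a) * g + \<iota> a * (g - \<iota> b) \<in> max_ideal P"
    by (intro max_ideal_add max_ideal_mult assms residue_in_place[OF assms(2)] iota_in_place)
  then show ?thesis by (simp add: algebra_simps)
qed

lemma residue_add:
  assumes "f - \<iota> a \<in> max_ideal P" "g - \<iota> b \<in> max_ideal P"
  shows "f + g - \<iota> (a + b) \<in> max_ideal P"
  using max_ideal_add[OF assms] by (simp add: algebra_simps)

lemma residue_iota: "\<iota> a - \<iota> a \<in> max_ideal P"
  using zero_in_max_ideal by simp

lemma residue_power:
  assumes "f - \<iota> a \<in> max_ideal P"
  shows "f ^ n - \<iota> (a ^ n) \<in> max_ideal P"
proof (induction n)
  case 0
  then show ?case using residue_iota[of 1] by simp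
next
  case (Suc n)
  show ?case using residue_mult[OF assms Suc] by simp
qed

lemma residue_unit:
  assumes "f - \<iota> a \<in> max_ideal P" "a \<noteq> 0"
  shows "f \<notin> max_ideal P" "f \<noteq> 0" "inverse f \<in> P" "inverse f - \<iota> (inverse a) \<in> max_ideal P"
proof -
  show 1: "f \<notin> max_ideal P"
    using residue_unique[OF assms(1), of 0] assms(2) by auto
  then show 2: "f \<noteq> 0" and 3: "inverse f \<in> P"
    using place_unit residue_in_place[OF assms(1)] by auto
  have "(f - \<iota> a) * (- inverse f * \<iota> (inverse a)) \<in> max_ideal P"
    by (intro max_ideal_mult assms place_closed 3 iota_in_place)
  moreover have "(f - \<iota> a) * (- inverse f * \<iota> (inverse a)) = inverse f - \<iota> (inverse a)"
    using 2 assms(2) by (simp add: algebra_simps)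
  ultimately show "inverse f - \<iota> (inverse a) \<in> max_ideal P" by simp
qed

end

text \<open>Quantified over a set of places because it is applied before it is known that only one
  place lies over a given point. The residue may depend on the place.\<close>

definition has_unit_residue :: "'f set set \<Rightarrow> 'f \<Rightarrow> bool" where
  "has_unit_residue \<P> u \<longleftrightarrow> (\<forall>P\<in>\<P>. \<exists>a. a \<noteq> 0 \<and> u - \<iota> a \<in> max_ideal P)"

lemma has_unit_residue_mult:
  assumes "\<And>P. P \<in> \<P> \<Longrightarrow> place \<iota> P" "has_unit_residue \<P> u" "has_unit_residue \<P> v"
  shows "has_unit_residue \<P> (u * v)"
  using assms residue_mult unfolding has_unit_residue_def by (metis mult_eq_0_iff)

lemma has_unit_residue_inverse:
  assumes "\<And>P. P \<in> \<P> \<Longrightarrow> place \<iota> P" "has_unit_residue \<P> u"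
  shows "has_unit_residue \<P> (inverse u)"
  using assms residue_unit(4) unfolding has_unit_residue_def by (metis nonzero_imp_inverse_nonzero)

text \<open>The equation says that \<open>f\<close> has valuation \<open>b - a\<close> at
  \<open>P\<close>; the two exponents avoid a negative one.\<close>

lemma uniformizer_normal_form:
  assumes P: "place \<iota> P" and \<pi>: "\<pi> \<in> max_ideal P" "\<pi> \<noteq> 0"
    and u: "u - \<iota> e \<in> max_ideal P" "e \<noteq> 0" and f: "f * \<pi> ^ a = u * \<pi> ^ b"
  shows "f \<in> P \<longleftrightarrow> a \<le> b" "a < b \<Longrightarrow> f \<in> max_ideal P" "a = b \<Longrightarrow> f = u"
proof -
  note U = residue_unit[OF P u]
  have less: "f \<in> max_ideal P" if "a < b"
  proof -
    have "f * \<pi> ^ a = (u * \<pi> ^ (b - a)) * \<pi> ^ a" using f that by (simp flip: power_add)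
    then have "f = u * \<pi> ^ (b - a)" using \<pi> by simp
    then show ?thesis
      using residue_in_place[OF P u(1)] power_in_max_ideal[OF P \<pi>(1), of "b - a"] that max_ideal_mult[OF P]
      by auto
  qed
  have eq: "f = u" if "a = b" using f \<pi> that by simp
  have "f \<notin> P" if "a > b"
  proof
    assume "f \<in> P"
    have "(f * \<pi> ^ (a - b)) * \<pi> ^ b = u * \<pi> ^ b" using f that by (simp add: mult.assoc flip: power_add)
    then have "f * \<pi> ^ (a - b) = u" using \<pi> by simp
    moreover have "f * \<pi> ^ (a - b) \<in> max_ideal P"
      using \<open>f \<in> P\<close> power_in_max_ideal[OF P \<pi>(1), of "a - b"] that max_ideal_mult[OF P] by auto
    ultimately show False using U by simp
  qed
  then show "f \<in> P \<longleftrightarrow> a \<le> b"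
    using less eq max_ideal_subset[OF P] residue_in_place[OF P u(1)] by (metis le_neq_implies_less not_le)
  show "a < b \<Longrightarrow> f \<in> max_ideal P" "a = b \<Longrightarrow> f = u" by (fact less, fact eq)
qed

text \<open>Membership of \<open>f\<close> is decided by \<open>a \<le> b\<close>, a condition in
  which the place does not occur, so all places in \<open>\<P>\<close> contain the same functions.
  The residue of \<open>f\<close> is that of \<open>u\<close> if \<open>a = b\<close> and 0 if
  \<open>a < b\<close>, hence it lies in the ground field.\<close>

lemma places_with_common_uniformizer:
  assumes \<P>: "\<And>P. P \<in> \<P> \<Longrightarrow> place \<iota> P \<and> \<pi> \<in> max_ideal P" and \<pi>: "\<pi> \<noteq> 0"
    and nf: "\<And>f. f \<noteq> 0 \<Longrightarrow> \<exists>a b u. has_unit_residue \<P> u \<and> f * \<pi> ^ a = u * \<pi> ^ b"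
  shows "P \<in> \<P> \<Longrightarrow> Q \<in> \<P> \<Longrightarrow> P = Q" "P \<in> \<P> \<Longrightarrow> P \<in> rational_points \<iota>"
proof -
  have sub: "P \<subseteq> Q" if "P \<in> \<P>" "Q \<in> \<P>" for P Q
  proof
    fix f assume f: "f \<in> P"
    show "f \<in> Q"
    proof (cases "f = 0")
      case True
      then show ?thesis using \<P>[OF \<open>Q \<in> \<P>\<close>] place_closed(2) by simp
    next
      case False
      then obtain a b u where u: "has_unit_residue \<P> u" "f * \<pi> ^ a = u * \<pi> ^ b" using nf by metis
      then show ?thesis
        using uniformizer_normal_form(1)[OF _ _ \<pi> _ _ u(2)] \<P> that f
        unfolding has_unit_residue_def by metis
    qed
  qed
  then show "P \<in> \<P> \<Longrightarrow> Q \<in> \<P> \<Longrightarrow> P = Q" by blast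
  assume P: "P \<in> \<P>"
  have "\<exists>a. f - \<iota> a \<in> max_ideal P" if "f \<in> P" for f
  proof (cases "f = 0")
    case True
    then have "f - \<iota> 0 \<in> max_ideal P" using \<P>[OF P] zero_in_max_ideal by simp
    then show ?thesis by blast
  next
    case False
    then obtain a b u where u: "has_unit_residue \<P> u" "f * \<pi> ^ a = u * \<pi> ^ b" using nf by metis
    then obtain e where e: "e \<noteq> 0" "u - \<iota> e \<in> max_ideal P"
      using P unfolding has_unit_residue_def by blast
    note N = uniformizer_normal_form[OF _ _ \<pi> e(2,1) u(2)]
    show ?thesis
    proof (cases "a = b")
      case True
      then show ?thesis using N(3) \<P>[OF P] e by auto
    next
      case False
      then have "f - \<iota> 0 \<in> max_ideal P" using N(1,2) \<P>[OF P] \<open>f \<in> P\<close> by auto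
      then show ?thesis by blast
    qed
  qed
  then show "P \<in> rational_points \<iota>" using \<P>[OF P] by (auto simp: rational_points_def)
qed

end

section \<open>Counting in finite fields\<close>

lemma card_power_roots_le:
  fixes c :: "'a::idom"
  assumes "n > 0"
  shows "card {x. x ^ n = c} \<le> n"
proof -
  have "coeff (monom 1 n - [:c:]) n = 1" using assms by (simp add: coeff_pCons split: nat.split)
  then have "monom 1 n - [:c:] \<noteq> 0" by force
  then have "card {x. poly (monom 1 n - [:c:]) x = 0} \<le> degree (monom 1 n - [:c:])"
    by (rule card_poly_roots_bound)
  also have "degree (monom 1 n - [:c:]) \<le> n" by (intro degree_diff_le degree_monom_le) auto
  finally show ?thesis by (simp add: poly_monom)
qed

text \<open>Pigeonhole with equality: \<open>r * s\<close> elements spread over at most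
  \<open>r\<close> fibers of size at most \<open>s\<close> fill every fiber. This turns upper bounds
  by polynomial degrees into exact counts.\<close>

lemma card_fiber_eq:
  assumes "finite A" "finite B" "f ` A \<subseteq> B" and s: "s > 0"
    and B: "card B \<le> r" and fib: "\<And>y. y \<in> B \<Longrightarrow> card {x \<in> A. f x = y} \<le> s"
    and A: "card A = r * s" and y: "y \<in> B"
  shows "card {x \<in> A. f x = y} = s"
proof (rule ccontr)
  assume "\<not> ?thesis"
  then have lt: "card {x \<in> A. f x = y} < s" using fib[OF y] by simp
  have "card A = (\<Sum>y\<in>B. card {x \<in> A. f x = y})"
    using sum.group[OF assms(1-3), of "\<lambda>_. 1 :: nat"] by simp
  also have "\<dots> < (\<Sum>y\<in>B. s)"
    by (rule sum_strict_mono_ex1) (use assms lt in auto)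
  also have "\<dots> \<le> r * s" using B by simp
  finally show False using A by simp
qed

lemma power_card_minus_one_eq_1:
  fixes x :: "'k::{field,finite}"
  assumes "x \<noteq> 0"
  shows "x ^ (CARD('k) - 1) = 1"
proof -
  let ?U = "UNIV - {0 :: 'k}"
  have "(\<Prod>y\<in>?U. y) = (\<Prod>y\<in>?U. x * y)"
    by (rule prod.reindex_bij_witness[of _ "\<lambda>y. x * y" "\<lambda>y. y / x"]) (use assms in auto)
  also have "\<dots> = x ^ card ?U * (\<Prod>y\<in>?U. y)" by (simp add: prod.distrib)
  finally have "x ^ card ?U = 1" by simp
  then show ?thesis by (simp add: card_Diff_singleton)
qed

lemma power_card_eq:
  fixes x :: "'k::{field,finite}"
  shows "x ^ CARD('k) = x"
proof (cases "x = 0")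
  case False
  have "x ^ CARD('k) = x * x ^ (CARD('k) - 1)"
    by (metis Suc_diff_1 power_Suc zero_less_card_finite)
  then show ?thesis using power_card_minus_one_eq_1[OF False] by simp
qed simp

section \<open>Trace and power maps over the field with \<open>q\<^sup>2\<close> elements\<close>

locale maximal_curve = ground_embedding \<iota>
  for \<iota> :: "'k::{field,finite} \<Rightarrow> 'f::field" +
  fixes X Y :: 'f and q m c :: nat
  assumes q_primepow: "primepow q" and card_k: "CARD('k) = q\<^sup>2"
    and mc: "m * c = q + 1" and c_ge: "c \<ge> 3" and m_ge: "m \<ge> 2"
    and function_field: "is_function_field (curve_poly q m) \<iota> X Y"
begin

lemma q_ge: "q > 1"
  using primepow_gt_Suc_0[OF q_primepow] by simp

lemma two_m_le: "2 * m \<le> q"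
proof -
  have "3 * m \<le> m * c" using c_ge by (simp add: mult.commute)
  then show ?thesis using mc m_ge by linarith
qed

lemma m_less: "m < q"
  using two_m_le m_ge by linarith

text \<open>The characteristic divides the cardinality of the field, a power of the prime underlying
  \<open>q\<close>, so the two primes agree. This is what makes \<open>x \<mapsto> x^q\<close>
  additive.\<close>

lemma frobenius_exponent:
  obtains k where "prime CHAR('k)" "q = CHAR('k) ^ k"
proof -
  have CHAR: "prime CHAR('k)"
    by (rule prime_CHAR_semidom) (rule finite_imp_CHAR_pos, simp)
  obtain p k where p: "prime p" "k > 0" "q = p ^ k"
    using q_primepow by (auto simp: primepow_def)
  have "CHAR('k) dvd p ^ (k * 2)"
    using CHAR_dvd_CARD[where ?'a = 'k] by (simp add: card_k p power_mult)
  then have "CHAR('k) = p" using CHAR p(1) by (metis prime_dvd_power primes_dvd_imp_eq)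
  then show ?thesis using that CHAR p by blast
qed

text \<open>Stated for all semirings of the same characteristic, since it is applied both in
  \<open>k\<close> and in \<open>k[x][y]\<close>.\<close>

lemma frobenius_add:
  fixes a b :: "'a::comm_semiring_1"
  assumes "CHAR('a) = CHAR('k)"
  shows "(a + b) ^ q = a ^ q + b ^ q"
  using frobenius_exponent assms freshmans_dream' by metis

lemma frobenius_sum:
  fixes f :: "'i \<Rightarrow> 'a::comm_semiring_1"
  assumes "CHAR('a) = CHAR('k)"
  shows "sum f A ^ q = (\<Sum>i\<in>A. f i ^ q)"
  using frobenius_exponent assms freshmans_dream_sum' by metis

lemma power_q_q: "(a :: 'k) ^ q ^ 2 = a"
  using power_card_eq[of a] by (simp add: card_k)

text \<open>\<open>x \<mapsto> x^q + x\<close> is the trace to the subfield \<open>z^q = z\<close>.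
  Degrees bound this subfield and each fiber by \<open>q\<close>; the field has \<open>q * q\<close>
  elements, so the bounds are attained.\<close>

lemma card_trace_fiber:
  fixes e :: 'k
  assumes "e ^ q = e"
  shows "card {b. b ^ q + b = e} = q"
proof -
  have "card {x \<in> UNIV. x ^ q + x = e} = q"
  proof (rule card_fiber_eq[where B = "{z :: 'k. z ^ q = z}" and r = q])
    have "(x ^ q + x) ^ q = x ^ q + x" for x :: 'k
    proof -
      have "(x ^ q + x) ^ q = (x ^ q) ^ q + x ^ q" by (rule frobenius_add) simp
      also have "(x ^ q) ^ q = x"
        using power_q_q[of x] by (simp add: power2_eq_square flip: power_mult)
      finally show ?thesis by (simp only: add.commute)
    qed
    then show "(\<lambda>x. x ^ q + x) ` UNIV \<subseteq> {z :: 'k. z ^ q = z}" by blast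
    show "q > 0" using q_ge by simp
    \<comment> \<open>Used with \<open>a = - 1\<close> and \<open>e = 0\<close> for the subfield,
      and with \<open>a = 1\<close> for the fibers.\<close>
    have deg: "card {x :: 'k. x ^ q + a * x = e} \<le> q" for a e
    proof -
      let ?p = "monom 1 q + [:- e, a:]"
      have c: "coeff ?p q = 1" using q_ge by (auto simp: coeff_pCons split: nat.split)
      then have "?p \<noteq> 0" by force
      then have "card {x. poly ?p x = 0} \<le> degree ?p"
        by (rule card_poly_roots_bound)
      also have "degree ?p \<le> q" using q_ge by (intro degree_add_le degree_monom_le) auto
      finally show ?thesis by (simp add: poly_monom algebra_simps)
    qed
    have "{z :: 'k. z ^ q = z} = {z. z ^ q + (- 1) * z = 0}" by auto
    then show "card {z :: 'k. z ^ q = z} \<le> q" using deg[of "- 1" 0] by simp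
    show "card {x \<in> UNIV. x ^ q + x = y} \<le> q" for y :: 'k using deg[of 1 y] by simp
    show "CARD('k) = q * q" by (simp add: card_k power2_eq_square)
    show "e \<in> {z. z ^ q = z}" using assms by simp
  qed auto
  then show ?thesis by simp
qed

text \<open>The \<open>m\<close>-th powers of nonzero elements are \<open>c(q - 1)\<close>-th roots
  of unity, and the multiplicative group has \<open>c(q - 1) * m\<close> elements, so again the
  degree bounds are attained. Here \<open>e\<close> is such a root because
  \<open>e^(q - 1) = 1\<close>.\<close>

lemma card_power_fiber:
  fixes e :: 'k
  assumes "e ^ q = e" "e \<noteq> 0"
  shows "card {x. x ^ m = e} = m"
proof -
  let ?n = "c * (q - 1)"
  have n: "CARD('k) - 1 = ?n * m"
  proof -
    have "q\<^sup>2 - 1 = (q + 1) * (q - 1)" using q_ge by (simp add: power2_eq_square algebra_simps)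
    also have "\<dots> = c * (q - 1) * m" unfolding mc[symmetric] by simp
    finally show ?thesis by (simp add: card_k)
  qed
  have m: "m > 0" using m_ge by simp
  have "card {x \<in> UNIV - {0}. x ^ m = e} = m"
  proof (rule card_fiber_eq[where B = "{z :: 'k. z ^ ?n = 1}" and r = ?n])
    have "(x ^ m) ^ ?n = 1" if "x \<noteq> 0" for x :: 'k
      using power_card_minus_one_eq_1[OF that] unfolding n by (metis power_mult mult.commute)
    then show "(\<lambda>x. x ^ m) ` (UNIV - {0}) \<subseteq> {z :: 'k. z ^ ?n = 1}" by blast
    show "card {z :: 'k. z ^ ?n = 1} \<le> ?n"
      using c_ge q_ge by (intro card_power_roots_le) auto
    have "card {x \<in> UNIV - {0}. x ^ m = y} \<le> card {x. x ^ m = y}" for y :: 'k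
      by (intro card_mono) auto
    also have "card {x. x ^ m = y} \<le> m" for y :: 'k by (rule card_power_roots_le[OF m])
    finally show "card {x \<in> UNIV - {0}. x ^ m = y} \<le> m" for y :: 'k .
    show "card (UNIV - {0 :: 'k}) = ?n * m" using n by (simp add: card_Diff_singleton)
    have "e * e ^ (q - 1) = e" using assms(1) q_ge by (metis Suc_diff_1 less_trans power_Suc zero_less_one)
    then have "e ^ (q - 1) = 1" using assms(2) by simp
    then show "e \<in> {z. z ^ ?n = 1}" by (simp add: mult.commute[of c] power_mult)
  qed (use m in auto)
  moreover have "{x \<in> UNIV - {0}. x ^ m = e} = {x. x ^ m = e}" using assms m by (auto simp: power_0_left)
  ultimately show ?thesis by simp
qed

end

section \<open>The coordinate ring\<close>

lemma monic_division:
  fixes f g :: "'a::idom poly"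
  assumes "lead_coeff g = 1" "degree g > 0"
  obtains h r where "f = g * h + r" "degree r < degree g"
proof -
  obtain h r where hr: "pseudo_divmod f g = (h, r)" by (cases "pseudo_divmod f g") auto
  have "g \<noteq> 0" using assms by auto
  from pseudo_divmod[OF this hr] have "f = g * h + r" "degree r < degree g"
    using assms by auto
  then show ?thesis using that by blast
qed

lemma degree_less_dvd_imp_0:
  fixes g r :: "'a::idom poly"
  assumes "g dvd r" "degree r < degree g"
  shows "r = 0"
  using dvd_imp_degree_le[OF assms(1)] assms(2) by linarith

section \<open>Evaluation of polynomials as a ring homomorphism\<close>

lemma (in ground_embedding) map_poly_iota_simps [simp]:
  "poly (map_poly \<iota> (p + r)) x = poly (map_poly \<iota> p) x + poly (map_poly \<iota> r) x"
  "poly (map_poly \<iota> (p * r)) x = poly (map_poly \<iota> p) x * poly (map_poly \<iota> r) x"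
  "poly (map_poly \<iota> (smult a p)) x = \<iota> a * poly (map_poly \<iota> p) x"
  "poly (map_poly \<iota> (- p)) x = - poly (map_poly \<iota> p) x"
  "poly (map_poly \<iota> (p - r)) x = poly (map_poly \<iota> p) x - poly (map_poly \<iota> r) x"
  "map_poly \<iota> (pCons a p) = pCons (\<iota> a) (map_poly \<iota> p)"
  "map_poly \<iota> (monom a n) = monom (\<iota> a) n"
proof -
  show pc: "map_poly \<iota> (pCons a p) = pCons (\<iota> a) (map_poly \<iota> p)" for a p
    by (simp add: map_poly_pCons)
  show "map_poly \<iota> (monom a n) = monom (\<iota> a) n" by (simp add: map_poly_monom)
  have "map_poly \<iota> (p + r) = map_poly \<iota> p + map_poly \<iota> r" for p r
    by (rule poly_eqI) (simp add: coeff_map_poly)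
  then show add: "poly (map_poly \<iota> (p + r)) x = poly (map_poly \<iota> p) x + poly (map_poly \<iota> r) x" for p r
    by simp
  have smult: "map_poly \<iota> (smult a p) = smult (\<iota> a) (map_poly \<iota> p)" for a p
    by (rule map_poly_smult) auto
  show "poly (map_poly \<iota> (smult a p)) x = \<iota> a * poly (map_poly \<iota> p) x"
    by (simp add: smult)
  show uminus: "poly (map_poly \<iota> (- p)) x = - poly (map_poly \<iota> p) x" for p
    using add[of p "- p"] by (simp add: minus_unique)
  show "poly (map_poly \<iota> (p - r)) x = poly (map_poly \<iota> p) x - poly (map_poly \<iota> r) x"
    using add[of p "- r"] by (simp add: uminus)
  show "poly (map_poly \<iota> (p * r)) x = poly (map_poly \<iota> p) x * poly (map_poly \<iota> r) x"
    by (induction p) (simp_all add: add smult pc algebra_simps)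
qed

lemma (in ground_embedding) eval2_simps [simp]:
  "eval2 \<iota> x y 0 = 0" "eval2 \<iota> x y 1 = 1"
  "eval2 \<iota> x y [:a:] = poly (map_poly \<iota> a) x"
  "eval2 \<iota> x y (pCons a p) = poly (map_poly \<iota> a) x + y * eval2 \<iota> x y p"
  "eval2 \<iota> x y (p + r) = eval2 \<iota> x y p + eval2 \<iota> x y r"
  "eval2 \<iota> x y (p * r) = eval2 \<iota> x y p * eval2 \<iota> x y r"
  "eval2 \<iota> x y (smult a p) = poly (map_poly \<iota> a) x * eval2 \<iota> x y p"
  "eval2 \<iota> x y (- p) = - eval2 \<iota> x y p"
  "eval2 \<iota> x y (p - r) = eval2 \<iota> x y p - eval2 \<iota> x y r"
  "eval2 \<iota> x y (p ^ n) = eval2 \<iota> x y p ^ n"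
  "eval2 \<iota> x y (monom a n) = poly (map_poly \<iota> a) x * y ^ n"
proof -
  let ?E = "\<lambda>a. poly (map_poly \<iota> a) x"
  show 0: "eval2 \<iota> x y 0 = 0" and 1: "eval2 \<iota> x y 1 = 1" by (auto simp: eval2_def)
  show "eval2 \<iota> x y [:a:] = ?E a" by (simp add: eval2_def map_poly_pCons)
  show pc: "eval2 \<iota> x y (pCons a p) = ?E a + y * eval2 \<iota> x y p" for a p
    by (simp add: eval2_def map_poly_pCons)
  have "map_poly ?E (p + r) = map_poly ?E p + map_poly ?E r" for p r
    by (rule poly_eqI) (simp add: coeff_map_poly)
  then show add: "eval2 \<iota> x y (p + r) = eval2 \<iota> x y p + eval2 \<iota> x y r" for p r
    by (simp add: eval2_def)
  have "map_poly ?E (smult a p) = smult (?E a) (map_poly ?E p)" for a p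
    by (rule map_poly_smult) auto
  then show smult: "eval2 \<iota> x y (smult a p) = ?E a * eval2 \<iota> x y p" for a p
    by (simp add: eval2_def)
  show mult: "eval2 \<iota> x y (p * r) = eval2 \<iota> x y p * eval2 \<iota> x y r" for p r
    by (induction p) (simp_all add: add smult pc 0 algebra_simps)
  show uminus: "eval2 \<iota> x y (- p) = - eval2 \<iota> x y p" for p
    using add[of p "- p"] by (simp add: 0 minus_unique)
  show "eval2 \<iota> x y (p - r) = eval2 \<iota> x y p - eval2 \<iota> x y r" for p r
    using add[of p "- r"] by (simp add: uminus)
  show "eval2 \<iota> x y (p ^ n) = eval2 \<iota> x y p ^ n" by (induction n) (simp_all add: 1 mult)
  show "eval2 \<iota> x y (monom a n) = ?E a * y ^ n"
    by (simp add: eval2_def map_poly_monom poly_monom)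
qed

lemma (in ground_embedding) eval2_prod:
  "eval2 \<iota> x y (prod f I) = (\<Prod>i\<in>I. eval2 \<iota> x y (f i))"
  by (induction I rule: infinite_finite_induct) auto

lemma (in ground_embedding) eval2_sum:
  "eval2 \<iota> x y (sum f I) = (\<Sum>i\<in>I. eval2 \<iota> x y (f i))"
  by (induction I rule: infinite_finite_induct) auto

section \<open>Normal forms of functions and integral closedness of \<open>k[X, Y]\<close>\<close>

context maximal_curve
begin

abbreviation "g \<equiv> curve_poly q m :: 'k poly poly"
abbreviation "ev \<equiv> eval2 \<iota> X Y"
abbreviation "evx a \<equiv> poly (map_poly \<iota> a) X"

lemmas ev_eq_0_iff = function_field[unfolded is_function_field_def, THEN conjunct2, THEN conjunct1, rule_format]
  and function_field_quotient =
    function_field[unfolded is_function_field_def, THEN conjunct2, THEN conjunct2, rule_format]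

lemma curve_eq: "Y ^ q + Y = X ^ m"
  using ev_eq_0_iff[of g] by (simp add: curve_poly_def poly_monom)

lemma degree_g: "degree g = q" and lead_coeff_g: "lead_coeff g = 1"
proof -
  have c: "coeff g q = 1"
    using q_ge by (auto simp: curve_poly_def coeff_pCons split: nat.split)
  have "degree g \<le> q"
    unfolding curve_poly_def using q_ge
    by (intro degree_diff_le degree_add_le order.trans[OF degree_monom_le]) simp_all
  then show d: "degree g = q" using c le_degree[of g q] by simp
  show "lead_coeff g = 1" unfolding d by (rule c)
qed

lemma g_division:
  obtains h r where "p = g * h + r" "degree r < q"
proof -
  obtain h r where "p = g * h + r" "degree r < degree g"
    by (rule monic_division[OF lead_coeff_g, of p]) (use q_ge in \<open>simp add: degree_g\<close>)
  then show ?thesis using that degree_g by simp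
qed

lemma evx_eq_0_iff [simp]: "evx a = 0 \<longleftrightarrow> a = 0"
proof
  assume "evx a = 0"
  then have "g dvd [:a:]" by (simp flip: ev_eq_0_iff)
  then have "[:a:] = 0" by (rule degree_less_dvd_imp_0) (use q_ge in \<open>simp add: degree_g\<close>)
  then show "a = 0" by simp
qed simp

lemma ev_low_degree_eq_0_iff:
  assumes "degree p < q"
  shows "ev p = 0 \<longleftrightarrow> p = 0"
proof
  assume "ev p = 0"
  then have "g dvd p" by (simp only: ev_eq_0_iff)
  then show "p = 0" by (rule degree_less_dvd_imp_0) (simp only: degree_g assms)
qed simp

lemma X_nonzero: "X \<noteq> 0" and Y_nonzero: "Y \<noteq> 0"
proof -
  show "X \<noteq> 0" using evx_eq_0_iff[of "[:0, 1:]"] by (simp del: evx_eq_0_iff)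
  show "Y \<noteq> 0"
  proof
    assume "Y = 0"
    then have "X ^ m = 0" using curve_eq q_ge by (simp add: power_0_left)
    then show False using \<open>X \<noteq> 0\<close> by simp
  qed
qed

lemma translate_power_q: "[:[:b:], 1:] ^ q = monom 1 q + [:[:b ^ q:] :: 'k poly:]"
proof -
  have "[:[:b:], 1:] = monom 1 1 + [:[:b:] :: 'k poly:]" by (simp add: monom_altdef)
  then have "[:[:b:], 1:] ^ q = monom 1 1 ^ q + [:[:b:] :: 'k poly:] ^ q"
    by (simp only:) (intro frobenius_add, simp)
  then show ?thesis by (simp add: monom_altdef poly_const_pow)
qed

lemma uminus_power_q: "(- b :: 'k) ^ q = - (b ^ q)"
proof -
  have "(b + - b) ^ q = b ^ q + (- b) ^ q" by (rule frobenius_add) simp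
  then show ?thesis using q_ge by (simp add: power_0_left minus_unique)
qed

lemma pcompose_g_translate:
  assumes "b ^ q + b = 0"
  shows "pcompose g [:[:b:], 1:] = g"
proof -
  have mon: "pcompose (monom 1 n) r = r ^ n" for n and r :: "'k poly poly"
    by (induction n) (auto simp: pcompose_1 monom_Suc pcompose_pCons simp flip: one_pCons)
  have "[:[:b ^ q:]:] + [:[:b:]:] = (0 :: 'k poly poly)" using assms by simp
  moreover have "[:[:b:], 1:] = monom 1 1 + [:[:b:] :: 'k poly:]" by (simp add: monom_altdef)
  ultimately show ?thesis
    unfolding curve_poly_def pcompose_add pcompose_diff mon translate_power_q pcompose_const power_one_right
    by (simp add: algebra_simps)
qed

text \<open>The product of the translates of \<open>p\<close> under \<open>y \<mapsto> y + b\<close>, where \<open>b\<^sup>q + b = 0\<close>, is invariant, and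
  so is its remainder modulo \<open>g\<close>. Being of degree less than \<open>q\<close>, this remainder is constant in \<open>y\<close>.\<close>

lemma norm_multiple:
  assumes "ev p \<noteq> 0"
  obtains p' a where "a \<noteq> 0" "ev p * ev p' = evx a"
proof -
  define B where "B = {b :: 'k. b ^ q + b = 0}"
  define T where "T b = [:[:b:], 1 :: 'k poly:]" for b
  have card_B: "card B = q" using card_trace_fiber[of 0] q_ge by (simp add: B_def power_0_left)
  have B_closed: "0 \<in> B" "b \<in> B \<Longrightarrow> b' \<in> B \<Longrightarrow> b + b' \<in> B" "b \<in> B \<Longrightarrow> - b \<in> B" for b b'
  proof -
    show "0 \<in> B" using q_ge by (simp add: B_def power_0_left)
    show add: "b \<in> B \<Longrightarrow> b' \<in> B \<Longrightarrow> b + b' \<in> B" for b b'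
      by (simp add: B_def frobenius_add) (metis add.assoc add.commute add_0)
    show "b \<in> B \<Longrightarrow> - b \<in> B" by (auto simp: B_def uminus_power_q add_eq_0_iff)
  qed
  have TT: "pcompose (pcompose r (T b)) (T b') = pcompose r (T (b + b'))" for r b b'
    by (simp add: T_def pcompose_pCons add.commute flip: pcompose_assoc)
  have T0: "pcompose r (T 0) = r" for r by (simp add: T_def)
  have gT: "pcompose g (T b) = g" if "b \<in> B" for b
    using pcompose_g_translate that by (simp add: T_def B_def)
  define N where "N = (\<Prod>b\<in>B. pcompose p (T b))"
  have NT: "pcompose N (T b') = N" if "b' \<in> B" for b'
    unfolding N_def pcompose_prod TT
    by (rule prod.reindex_bij_witness[of _ "\<lambda>b. b - b'" "\<lambda>b. b + b'"])
      (use that B_closed(2) B_closed(2)[OF _ B_closed(3)] in auto)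
  obtain h r where r: "N = g * h + r" "degree r < q" by (rule g_division)
  have rT: "pcompose r (T b) = r" if b: "b \<in> B" for b
  proof -
    have "g * h + r = g * pcompose h (T b) + pcompose r (T b)"
      using arg_cong[OF r(1), of "\<lambda>p. pcompose p (T b)"] NT[OF b] gT[OF b] r(1)
      by (simp add: pcompose_add pcompose_mult)
    then have "pcompose r (T b) - r = g * (h - pcompose h (T b))" by (simp add: algebra_simps)
    then have "g dvd pcompose r (T b) - r" by simp
    moreover have "degree (pcompose r (T b) - r) < degree g"
      unfolding degree_g by (intro degree_diff_less) (use r in \<open>auto simp: degree_pcompose T_def\<close>)
    ultimately show ?thesis using degree_less_dvd_imp_0 by (metis eq_iff_diff_eq_0)
  qed
  \<comment> \<open>By invariance \<open>r\<close> takes the value \<open>a\<close> at all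
    \<open>q\<close> constants \<open>[:b:]\<close> with \<open>b\<close> in \<open>B\<close>, which
    are too many for the degree of \<open>r - [:a:]\<close> unless this difference is zero.\<close>
  define a where "a = poly r 0"
  have r_eq: "r = [:a:]"
  proof (rule ccontr)
    assume "r \<noteq> [:a:]"
    then have "card {x. poly (r - [:a:]) x = 0} \<le> degree (r - [:a:])"
      by (intro card_poly_roots_bound) auto
    also have "degree (r - [:a:]) < q" by (intro degree_diff_less) (use r q_ge in auto)
    also have "q = card ((\<lambda>b. [:b:]) ` B)"
      by (subst card_image) (auto simp: card_B inj_on_def)
    also have "\<dots> \<le> card {x. poly (r - [:a:]) x = 0}"
    proof (rule card_mono)
      show "finite {x. poly (r - [:a:]) x = 0}"
        using \<open>r \<noteq> [:a:]\<close> by (intro poly_roots_finite) auto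
      have "poly r [:b:] = a" if "b \<in> B" for b
        using arg_cong[OF rT[OF that], of "\<lambda>p. poly p 0"] by (simp add: poly_pcompose T_def a_def)
      then show "(\<lambda>b. [:b:]) ` B \<subseteq> {x. poly (r - [:a:]) x = 0}" by auto
    qed
    finally show False by simp
  qed
  have "ev g = 0" by (simp add: ev_eq_0_iff)
  then have evN: "ev N = evx a" by (simp add: r r_eq)
  have "ev (pcompose p (T b)) \<noteq> 0" if "b \<in> B" for b
  proof
    assume "ev (pcompose p (T b)) = 0"
    then obtain s where "pcompose p (T b) = g * s" by (auto simp: ev_eq_0_iff)
    then have "p = g * pcompose s (T (- b))"
      using arg_cong[of _ _ "\<lambda>p. pcompose p (T (- b))"] gT[OF B_closed(3)[OF that]]
      by (metis TT T0 pcompose_mult add.right_inverse)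
    then have "g dvd p" by (metis dvd_triv_left)
    then show False using assms by (simp add: ev_eq_0_iff)
  qed
  then have "ev N \<noteq> 0" by (simp add: N_def eval2_prod)
  \<comment> \<open>The factor for \<open>b = 0\<close> is \<open>p\<close> itself; the remaining
    ones form the cofactor \<open>p'\<close>.\<close>
  moreover have "N = p * (\<Prod>b\<in>B - {0}. pcompose p (T b))"
    unfolding N_def using B_closed(1) by (subst prod.remove[of B 0]) (auto simp: T0)
  ultimately show ?thesis using that[of a] evN by (metis eval2_simps(6) evx_eq_0_iff)
qed

text \<open>\<open>norm_multiple\<close> makes the denominator a polynomial in \<open>X\<close>
  alone; division by the monic \<open>g\<close> then lowers the degree of the numerator in
  \<open>y\<close>.\<close>

lemma standard_fraction:
  obtains p a where "degree p < q" "a \<noteq> 0" "f = ev p / evx a"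
proof -
  obtain p r where r: "ev r \<noteq> 0" "f = ev p / ev r" using function_field_quotient[of f] by blast
  obtain r' a where a: "a \<noteq> 0" "ev r * ev r' = evx a" using norm_multiple[OF r(1)] .
  obtain h s where s: "p * r' = g * h + s" "degree s < q" by (rule g_division)
  have "ev r' \<noteq> 0" using a by auto
  then have "f = ev (p * r') / evx a" using r by (simp add: field_simps flip: a(2))
  also have "ev (p * r') = ev s" unfolding s(1) by (simp add: ev_eq_0_iff[of g, THEN iffD2])
  finally show ?thesis using that s a by blast
qed

text \<open>Put \<open>W = x^m - y\<close>, so that \<open>y^q\<close> is \<open>W\<close> modulo
  \<open>g\<close>. If \<open>p\<close> is the sum of \<open>a_j y^j\<close>, then
  \<open>p^q\<close> is congruent to the sum \<open>Q\<close> of \<open>a_j^q W^j\<close>. As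
  \<open>Q\<close> has degree less than \<open>q\<close> in \<open>y\<close>, it equals
  \<open>\<pi>\<close> times the remainder of \<open>h\<close>, not just modulo \<open>g\<close>.
  Now \<open>y \<mapsto> W\<close> is an involution; applying it to \<open>Q\<close> shows that
  \<open>\<pi>\<close> divides each \<open>a_j^q\<close>, hence each \<open>a_j\<close>.\<close>

lemma dvd_of_power_q_dvd:
  assumes \<pi>: "prime_elem \<pi>" and p: "degree p < q" and eq: "p ^ q = [:\<pi>:] * h + g * h'"
  shows "[:\<pi>:] dvd p"
proof -
  define W where "W = [:monom 1 m, - 1 :: 'k poly:]"
  define Q where "Q = (\<Sum>j\<le>degree p. [:coeff p j ^ q:] * W ^ j)"
  have "p ^ q = (\<Sum>j\<le>degree p. monom (coeff p j) j) ^ q" by (simp only: poly_as_sum_of_monoms)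
  also have "\<dots> = (\<Sum>j\<le>degree p. monom (coeff p j) j ^ q)" by (intro frobenius_sum) simp
  also have "\<dots> = (\<Sum>j\<le>degree p. [:coeff p j ^ q:] * (monom 1 q) ^ j)"
    by (intro sum.cong refl) (simp add: monom_power smult_monom mult.commute)
  finally have pq: "p ^ q = (\<Sum>j\<le>degree p. [:coeff p j ^ q:] * (monom 1 q) ^ j)" .
  have gW: "g = monom 1 q - W" by (simp add: curve_poly_def W_def monom_altdef)
  have "g dvd p ^ q - Q"
    unfolding pq Q_def sum_subtractf[symmetric] right_diff_distrib[symmetric]
  proof (intro dvd_sum dvd_mult)
    show "g dvd monom 1 q ^ j - W ^ j" for j
      unfolding gW by (rule power_diff_sumr2[THEN dvdI])
  qed
  obtain h1 h0 where h: "h = g * h1 + h0" "degree h0 < q" by (rule g_division)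
  have degW: "degree (W ^ j) \<le> j" for j
    using degree_power_le[of W j] by (simp add: W_def)
  have "Q - [:\<pi>:] * h0 = g * (h' + [:\<pi>:] * h1) - (p ^ q - Q)"
    unfolding eq h by (simp add: algebra_simps)
  then have "g dvd Q - [:\<pi>:] * h0" using \<open>g dvd p ^ q - Q\<close> by (metis dvd_diff dvd_triv_left)
  moreover have "degree (Q - [:\<pi>:] * h0) < degree g"
  proof -
    have "degree ([:coeff p j ^ q:] * W ^ j) \<le> q - 1" if "j \<le> degree p" for j
      using degree_smult_le[of "coeff p j ^ q" "W ^ j"] degW[of j] that p by simp
    then have "degree Q \<le> q - 1" unfolding Q_def by (intro degree_sum_le) auto
    then have "degree Q < q" using q_ge by simp
    then show ?thesis
      using h(2) degree_smult_le[of \<pi> h0] unfolding degree_g by (intro degree_diff_less) auto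
  qed
  ultimately have "Q = [:\<pi>:] * h0" using degree_less_dvd_imp_0 by (metis eq_iff_diff_eq_0)
  then have "pcompose Q W = [:\<pi>:] * pcompose h0 W" by (simp add: pcompose_smult)
  moreover have "pcompose W W = [:0, 1:]" by (simp add: W_def pcompose_pCons)
  then have "pcompose (W ^ j) W = monom 1 j" for j
    by (induction j) (simp_all add: pcompose_1 pcompose_mult monom_Suc)
  then have "pcompose Q W = (\<Sum>j\<le>degree p. monom (coeff p j ^ q) j)"
    unfolding Q_def pcompose_sum pcompose_mult by (simp add: smult_monom)
  ultimately have "[:\<pi>:] dvd (\<Sum>j\<le>degree p. monom (coeff p j ^ q) j)" by (metis dvd_triv_left)
  then have dvd: "\<pi> dvd coeff (\<Sum>j\<le>degree p. monom (coeff p j ^ q) j) n" for n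
    by (simp only: const_poly_dvd_iff)
  have "\<pi> dvd coeff p n" for n
  proof (cases "n \<le> degree p")
    case True
    have "coeff (\<Sum>j\<le>degree p. monom (coeff p j ^ q) j) n = coeff p n ^ q"
      using True by (simp add: coeff_sum)
    then have "\<pi> dvd coeff p n ^ q" using dvd[of n] by simp
    then show ?thesis using \<pi> prime_elem_dvd_power by blast
  next
    case False
    then show ?thesis by (simp add: coeff_eq_0)
  qed
  then show ?thesis by (simp add: const_poly_dvd_iff)
qed

text \<open>As \<open>n \<le> q^n\<close>, the power with exponent \<open>q^n\<close> is divisible
  too. From there the exponent is divided by \<open>q\<close> again and again, reducing modulo
  \<open>g\<close> and using \<open>dvd_of_power_q_dvd\<close>, until it is 1.\<close>

lemma dvd_of_power_dvd:
  assumes \<pi>: "prime_elem \<pi>" and p: "degree p < q" and eq: "ev p ^ n = evx \<pi> * ev h"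
  shows "[:\<pi>:] dvd p"
proof -
  have red: "\<exists>h. ev r = evx \<pi> * ev h" if "ev r ^ q = evx \<pi> * ev h" for r h
  proof -
    obtain h1 r0 where r: "r = g * h1 + r0" "degree r0 < q" by (rule g_division)
    have evr: "ev r = ev r0" by (simp add: r ev_eq_0_iff[of g, THEN iffD2])
    then have "ev (r0 ^ q - [:\<pi>:] * h) = 0" using that by simp
    then obtain h' where "r0 ^ q - [:\<pi>:] * h = g * h'" unfolding ev_eq_0_iff by (elim dvdE)
    then have "r0 ^ q = [:\<pi>:] * h + g * h'" by (simp add: algebra_simps)
    from dvd_of_power_q_dvd[OF \<pi> r(2) this] obtain s where "r0 = [:\<pi>:] * s" ..
    then show ?thesis unfolding evr by (metis eval2_simps(3,6))
  qed
  have "n \<le> q ^ n" using q_ge by (simp add: less_imp_le power_gt_expt)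
  then have "ev p ^ (q ^ n) = ev p ^ n * ev p ^ (q ^ n - n)" by (simp flip: power_add)
  then have pqn: "ev p ^ (q ^ n) = evx \<pi> * ev (h * p ^ (q ^ n - n))" by (simp add: eq)
  have "\<exists>h. ev p ^ (q ^ l) = evx \<pi> * ev h" if "l \<le> n" for l
    using that
  proof (induction rule: inc_induct)
    case base
    then show ?case using pqn by blast
  next
    case (step l)
    then obtain h where "ev p ^ (q ^ Suc l) = evx \<pi> * ev h" by blast
    then have "ev (p ^ (q ^ l)) ^ q = evx \<pi> * ev h" by (simp add: mult.commute flip: power_mult)
    from red[OF this] show ?case by simp
  qed
  from this[of 0] obtain h where "ev p = evx \<pi> * ev h" by auto
  obtain h1 h0 where h: "h = g * h1 + h0" "degree h0 < q" by (rule g_division)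
  have "ev (p - [:\<pi>:] * h0) = 0"
    using \<open>ev p = _\<close> by (simp add: h ev_eq_0_iff[of g, THEN iffD2])
  moreover have "degree (p - [:\<pi>:] * h0) < q"
    using p h(2) degree_smult_le[of \<pi> h0] by (intro degree_diff_less) auto
  ultimately have "p = [:\<pi>:] * h0" using ev_low_degree_eq_0_iff by (metis eq_iff_diff_eq_0)
  then show ?thesis by (rule dvdI)
qed

end

section \<open>Points over the affine plane\<close>

abbreviation evalk :: "'k::field \<Rightarrow> 'k \<Rightarrow> 'k poly poly \<Rightarrow> 'k" where
  "evalk \<equiv> eval2 (\<lambda>x. x)"

lemma ground_embedding_id: "ground_embedding (\<lambda>x :: 'a::field. x)"
  by standard (simp add: field_embedding_def)

lemmas evalk_simps [simp] = ground_embedding.eval2_simps[OF ground_embedding_id, unfolded map_poly_id']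

lemma evalk_eq: "evalk a b p = poly (poly p [:b:]) a"
  by (induction p) simp_all

context ground_embedding
begin

lemma residue_poly:
  assumes P: "place \<iota> P" and x: "x - \<iota> a \<in> max_ideal P"
  shows "poly (map_poly \<iota> p) x - \<iota> (poly p a) \<in> max_ideal P"
proof (induction p)
  case 0
  then show ?case using zero_in_max_ideal[OF P] by simp
next
  case (pCons c p)
  show ?case
    using residue_add[OF P residue_iota[OF P] residue_mult[OF P x pCons(2)], of c] by simp
qed

lemma residue_eval2:
  assumes P: "place \<iota> P" and x: "x - \<iota> a \<in> max_ideal P" and y: "y - \<iota> b \<in> max_ideal P"
  shows "eval2 \<iota> x y p - \<iota> (evalk a b p) \<in> max_ideal P"
proof (induction p)
  case 0
  then show ?case using zero_in_max_ideal[OF P] by simp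
next
  case (pCons c p)
  show ?case
    using residue_add[OF P residue_poly[OF P x, of c] residue_mult[OF P y pCons(2)]] by simp
qed

end

section \<open>The place over a point of the affine curve\<close>

context maximal_curve
begin

text \<open>A set of places, because uniqueness and existence are only established by
  \<open>centered_unique\<close> and \<open>ex_centered\<close>.\<close>

definition centered :: "'k \<Rightarrow> 'k \<Rightarrow> 'f set set" where
  "centered a b = {P. place \<iota> P \<and> X - \<iota> a \<in> max_ideal P \<and> Y - \<iota> b \<in> max_ideal P}"

context
  fixes a b :: 'k
  assumes on_curve: "b ^ q + b = a ^ m"
begin

lemma evalk_g: "evalk a b g = 0"
  using on_curve by (simp add: curve_poly_def poly_monom)

lemma evalk_eqI:
  assumes "ev p = ev r"
  shows "evalk a b p = evalk a b r"
proof -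
  have "ev (p - r) = 0" using assms by simp
  then obtain h where "p - r = g * h" unfolding ev_eq_0_iff by (elim dvdE)
  then have "evalk a b (p - r) = 0" by (simp only: evalk_simps evalk_g mult_zero_left)
  then show ?thesis by simp
qed

text \<open>The curve equation has derivative 1 in \<open>y\<close>, so \<open>X - a\<close> should
  be a uniformizer. Explicitly, additivity of the \<open>q\<close>-th power gives
  \<open>(Y - b)(1 + (Y - b)^(q - 1)) = X^m - a^m\<close>; the second factor \<open>r\<close> has
  value 1 at \<open>(a, b)\<close>, and \<open>X - a\<close> divides the right-hand side.\<close>

lemma Y_minus_eq:
  obtains r w where "evalk a b r \<noteq> 0" "(Y - \<iota> b) * ev r = (X - \<iota> a) * ev w"
proof -
  define r where "r = 1 + [:[:- b:], 1:] ^ (q - 1)"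
  have "evalk a b r = 1" using q_ge by (simp add: r_def power_0_left)
  have "poly (monom 1 m - [:a ^ m:]) a = 0" by (simp add: poly_monom)
  then obtain w where w: "monom 1 m - [:a ^ m:] = [:- a, 1:] * w"
    unfolding poly_eq_0_iff_dvd by (elim dvdE)
  have "[:[:- b:], 1:] * r = [:[:- b:], 1:] + [:[:- b:], 1:] ^ q"
    unfolding r_def distrib_left mult_1_right
    using power_minus_mult[of q "[:[:- b:], 1:]"] q_ge by (simp only: mult.commute[of "_ ^ _"])
  also have "\<dots> = [:[:- b:], 1:] + (monom 1 q + [:[:- (b ^ q):]:])"
    by (simp only: translate_power_q uminus_power_q)
  finally have "ev ([:[:- b:], 1:] * r) = ev ([:[:- b:], 1:] + (monom 1 q + [:[:- (b ^ q):]:]))"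
    by (rule arg_cong)
  then have "(Y - \<iota> b) * ev r = (Y ^ q + Y) - \<iota> (b ^ q + b)"
    by (simp add: poly_monom algebra_simps)
  also have "\<dots> = evx (monom 1 m - [:a ^ m:])"
  proof -
    have "evx (monom 1 m + [:- (a ^ m):]) = X ^ m - \<iota> (a ^ m)"
      unfolding map_poly_iota_simps by (simp add: poly_monom)
    then show ?thesis by (simp add: curve_eq on_curve)
  qed
  also have "\<dots> = (X - \<iota> a) * ev [:w:]" unfolding w by (simp add: algebra_simps)
  finally show ?thesis using that[of r "[:w:]"] \<open>evalk a b r = 1\<close> by simp
qed

text \<open>In \<open>p = (y - b) s + p(x, b)\<close> the last term is divisible by
  \<open>x - a\<close>, and \<open>Y_minus_eq\<close> takes care of the first.\<close>

lemma divisible_if_vanishing: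
  assumes "evalk a b p = 0"
  obtains r p' where "evalk a b r \<noteq> 0" "ev p * ev r = (X - \<iota> a) * ev p'"
proof -
  have "[:- a, 1:] dvd poly p [:b:]" using assms by (simp add: evalk_eq poly_eq_0_iff_dvd)
  then obtain e where e: "poly p [:b:] = [:- a, 1:] * e" by (elim dvdE)
  define s where "s = synthetic_div p [:b:]"
  have "[:- [:b:], 1:] * s + [:poly p [:b:]:] = p"
    unfolding s_def by (rule synthetic_div_correct')
  then have "ev p = ev ([:- [:b:], 1:] * s + [:[:- a, 1:] * e:])" unfolding e by simp
  then have p: "ev p = (Y - \<iota> b) * ev s + (X - \<iota> a) * evx e" by (simp add: algebra_simps)
  obtain r w where r: "evalk a b r \<noteq> 0" "(Y - \<iota> b) * ev r = (X - \<iota> a) * ev w"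
    by (rule Y_minus_eq)
  have "ev p * ev r = (Y - \<iota> b) * ev r * ev s + (X - \<iota> a) * evx e * ev r"
    unfolding p by (simp add: algebra_simps)
  also have "\<dots> = (X - \<iota> a) * ev (w * s + [:e:] * r)"
    unfolding r(2) by (simp add: algebra_simps)
  finally show ?thesis using that r(1) by blast
qed

lemma X_minus_nonzero: "X - \<iota> a \<noteq> 0"
proof -
  have "evx [:- a, 1:] \<noteq> 0" unfolding evx_eq_0_iff by simp
  then show ?thesis by simp
qed

text \<open>The exponent \<open>k\<close> comes from the order at \<open>a\<close> of a norm
  multiple of \<open>p\<close>, and it bounds how often \<open>X - a\<close> can be extracted from
  \<open>p\<close>: each extraction lowers it by one, and for \<open>k = 0\<close> the product,
  hence \<open>p\<close>, does not vanish at \<open>(a, b)\<close>.\<close>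

lemma divide_out_uniformizer:
  assumes "ev p * ev p' * ev r = (X - \<iota> a) ^ k * ev s" "evalk a b r \<noteq> 0" "evalk a b s \<noteq> 0"
  shows "\<exists>n r s. evalk a b r \<noteq> 0 \<and> evalk a b s \<noteq> 0 \<and> ev p * ev r = (X - \<iota> a) ^ n * ev s"
  using assms
proof (induction k arbitrary: p r s)
  case 0
  then have "evalk a b (p * p' * r) = evalk a b s" by (intro evalk_eqI) simp
  then have "evalk a b p \<noteq> 0" using 0 by auto
  then show ?case by (intro exI[of _ 0] exI[of _ 1] exI[of _ p]) simp
next
  case (Suc k)
  show ?case
  proof (cases "evalk a b p = 0")
    case False
    then show ?thesis by (intro exI[of _ 0] exI[of _ 1] exI[of _ p]) simp
  next
    case True
    then obtain r1 p1 where 1: "evalk a b r1 \<noteq> 0" "ev p * ev r1 = (X - \<iota> a) * ev p1"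
      by (rule divisible_if_vanishing)
    have "(X - \<iota> a) * (ev p1 * ev p' * ev r) = ev p * ev p' * ev r * ev r1"
      by (simp add: mult_ac 1(2)[symmetric])
    also have "\<dots> = (X - \<iota> a) * ((X - \<iota> a) ^ k * ev (s * r1))"
      unfolding Suc.prems(1) by (simp add: mult_ac)
    finally have "ev p1 * ev p' * ev r = (X - \<iota> a) ^ k * ev (s * r1)"
      using X_minus_nonzero by simp
    from Suc.IH[OF this] Suc.prems 1 obtain n r2 s2 where
      2: "evalk a b r2 \<noteq> 0" "evalk a b s2 \<noteq> 0" "ev p1 * ev r2 = (X - \<iota> a) ^ n * ev s2"
      by auto
    have "ev p * ev (r1 * r2) = (X - \<iota> a) * (ev p1 * ev r2)" using 1(2) by (simp add: mult_ac)
    also have "\<dots> = (X - \<iota> a) ^ Suc n * ev s2" unfolding 2(3) by (simp add: mult_ac)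
    finally show ?thesis using 1 2
      by (intro exI[of _ "Suc n"] exI[of _ "r1 * r2"] exI[of _ s2]) auto
  qed
qed

lemma affine_normal_form:
  assumes "ev p \<noteq> 0"
  obtains n r s where "evalk a b r \<noteq> 0" "evalk a b s \<noteq> 0" "ev p * ev r = (X - \<iota> a) ^ n * ev s"
proof -
  obtain p' e where e: "e \<noteq> 0" "ev p * ev p' = evx e" using norm_multiple[OF assms] .
  obtain e' where e': "e = [:- a, 1:] ^ order a e * e'" "\<not> [:- a, 1:] dvd e'"
    using order_decomp[OF e(1)] by blast
  have "evx ([:- a, 1:] ^ n) = (X - \<iota> a) ^ n" for n
    using eval2_simps(10)[of X Y "[:[:- a, 1:]:]" n] by (simp add: poly_const_pow)
  then have "evx e = (X - \<iota> a) ^ order a e * evx e'"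
    by (subst e'(1)) simp
  then have "ev p * ev p' * ev 1 = (X - \<iota> a) ^ order a e * ev [:e':]"
    using e by simp
  moreover have "evalk a b 1 \<noteq> 0" "evalk a b [:e':] \<noteq> 0"
    using e'(2) by (simp_all add: poly_eq_0_iff_dvd)
  ultimately have "\<exists>n r s. evalk a b r \<noteq> 0 \<and> evalk a b s \<noteq> 0 \<and> ev p * ev r = (X - \<iota> a) ^ n * ev s"
    by (rule divide_out_uniformizer)
  then show ?thesis using that by blast
qed

lemma has_unit_residue_ev:
  assumes "evalk a b s \<noteq> 0"
  shows "has_unit_residue (centered a b) (ev s)"
  unfolding has_unit_residue_def
proof (intro ballI exI conjI)
  show "evalk a b s \<noteq> 0" by fact
  show "ev s - \<iota> (evalk a b s) \<in> max_ideal P" if "P \<in> centered a b" for P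
    using that unfolding centered_def by (elim CollectE conjE) (rule residue_eval2)
qed

lemma centered_unique: "P \<in> centered a b \<Longrightarrow> Q \<in> centered a b \<Longrightarrow> P = Q"
  and centered_rational: "P \<in> centered a b \<Longrightarrow> P \<in> rational_points \<iota>"
proof -
  have 1: "place \<iota> P \<and> X - \<iota> a \<in> max_ideal P" if "P \<in> centered a b" for P
    using that by (simp add: centered_def)
  have 2: "\<exists>k n u. has_unit_residue (centered a b) u \<and> f * (X - \<iota> a) ^ k = u * (X - \<iota> a) ^ n"
    if "f \<noteq> 0" for f
  proof -
    obtain p r where pr: "ev r \<noteq> 0" "f = ev p / ev r" using function_field_quotient[of f] by blast
    then have "ev p \<noteq> 0" using that by auto
    then obtain n r1 s1 where 1: "evalk a b r1 \<noteq> 0" "evalk a b s1 \<noteq> 0"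
      "ev p * ev r1 = (X - \<iota> a) ^ n * ev s1" by (rule affine_normal_form)
    obtain k r2 s2 where 2: "evalk a b r2 \<noteq> 0" "evalk a b s2 \<noteq> 0"
      "ev r * ev r2 = (X - \<iota> a) ^ k * ev s2" using affine_normal_form[OF pr(1)] .
    have nz: "ev s \<noteq> 0" if "evalk a b s \<noteq> 0" for s
      using evalk_eqI[of s 0] that by auto
    define u where "u = (ev s1 * ev r2) * inverse (ev r1 * ev s2)"
    have "has_unit_residue (centered a b) u"
      unfolding u_def
      by (intro has_unit_residue_mult has_unit_residue_inverse has_unit_residue_ev)
        (auto simp: 1(1,2) 2(1,2) centered_def)
    moreover have "f * (X - \<iota> a) ^ k = u * (X - \<iota> a) ^ n"
    proof -
      have "f * (X - \<iota> a) ^ k * (ev r * ev r1 * ev s2) = ev p * ev r1 * ((X - \<iota> a) ^ k * ev s2)"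
        using pr(1) by (simp add: pr(2))
      also have "\<dots> = (ev s1 * ev r2) * (X - \<iota> a) ^ n * ev r"
        unfolding 1(3) 2(3)[symmetric] by (simp add: mult_ac)
      also have "\<dots> = u * (X - \<iota> a) ^ n * (ev r * ev r1 * ev s2)"
        using nz[OF 1(1)] nz[OF 2(2)] by (simp add: u_def field_simps)
      finally show ?thesis using pr(1) nz[OF 1(1)] nz[OF 2(2)] by simp
    qed
    ultimately show ?thesis by blast
  qed
  show "P \<in> centered a b \<Longrightarrow> Q \<in> centered a b \<Longrightarrow> P = Q"
    and "P \<in> centered a b \<Longrightarrow> P \<in> rational_points \<iota>"
    by (rule places_with_common_uniformizer[OF 1 X_minus_nonzero 2]; assumption)+
qed

text \<open>\<open>A\<close> is the local ring of the plane curve at \<open>(a, b)\<close>, in which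
  \<open>X - a\<close> is not invertible. A place that contains \<open>A\<close> but not
  \<open>1/(X - a)\<close> has \<open>X - a\<close> in its maximal ideal, and \<open>Y - b\<close>
  is a multiple of \<open>X - a\<close> in \<open>A\<close>.\<close>

lemma ex_centered: "\<exists>P. P \<in> centered a b"
proof -
  define A where "A = {ev p / ev r | p r. evalk a b r \<noteq> 0}"
  have nz: "ev s \<noteq> 0" if "evalk a b s \<noteq> 0" for s
    using evalk_eqI[of s 0] that by auto
  have evA: "ev p \<in> A" for p
    unfolding A_def by (rule CollectI, rule exI[of _ p], rule exI[of _ 1]) simp
  have A: "subring_of A"
    unfolding subring_of_def
  proof (intro conjI ballI)
    show "1 \<in> A" using evA[of 1] by simp
    fix x y assume "x \<in> A" "y \<in> A"
    then obtain p r p' r' where x: "evalk a b r \<noteq> 0" "x = ev p / ev r"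
      and y: "evalk a b r' \<noteq> 0" "y = ev p' / ev r'" unfolding A_def by blast
    have "x - y = ev (p * r' - p' * r) / ev (r * r')"
      unfolding x(2) y(2) using nz[OF x(1)] nz[OF y(1)] by (simp add: field_simps)
    moreover have "x * y = ev (p * p') / ev (r * r')"
      unfolding x(2) y(2) by simp
    moreover have "evalk a b (r * r') \<noteq> 0" using x y by simp
    ultimately show "x - y \<in> A" "x * y \<in> A" unfolding A_def by blast+
  qed
  have "\<iota> e \<in> A" for e using evA[of "[:[:e:]:]"] by simp
  moreover have "X - \<iota> a \<in> A" using evA[of "[:[:- a, 1:]:]"] by simp
  moreover have "inverse (X - \<iota> a) \<notin> A"
  proof
    assume "inverse (X - \<iota> a) \<in> A"
    then obtain p r where r: "evalk a b r \<noteq> 0" "inverse (X - \<iota> a) = ev p / ev r"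
      unfolding A_def by blast
    then have "ev r = ev (p * [:[:- a, 1:]:])"
      using nz[OF r(1)] X_minus_nonzero by (simp add: field_simps)
    from evalk_eqI[OF this] show False using r(1) by simp
  qed
  ultimately obtain P where P: "place \<iota> P" "A \<subseteq> P" "inverse (X - \<iota> a) \<notin> P"
    using ex_place[OF emb A] by (metis image_subset_iff)
  have X: "X - \<iota> a \<in> max_ideal P"
    using P(2,3) \<open>X - \<iota> a \<in> A\<close> by (auto simp: max_ideal_def)
  obtain r w where r: "evalk a b r \<noteq> 0" "(Y - \<iota> b) * ev r = (X - \<iota> a) * ev w"
    by (rule Y_minus_eq)
  have "ev w / ev r \<in> A" using r(1) unfolding A_def by blast
  then have "(X - \<iota> a) * (ev w / ev r) \<in> max_ideal P"
    using max_ideal_mult(1)[OF P(1) X] P(2) by blast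
  also have "(X - \<iota> a) * (ev w / ev r) = Y - \<iota> b"
    using r(2) nz[OF r(1)] by (simp add: nonzero_divide_eq_eq)
  finally show ?thesis using P X by (auto simp: centered_def)
qed

end

end

section \<open>The point at infinity\<close>

context maximal_curve
begin

definition at_infinity :: "'f set set" where
  "at_infinity = {P. place \<iota> P \<and> X \<notin> P}"

text \<open>The exponent \<open>c\<close> is chosen to give valuation 1: \<open>X\<close> has order
  \<open>-q\<close>, \<open>Y\<close> has order \<open>-m\<close>, and
  \<open>mc - q = 1\<close>.\<close>

definition t :: 'f where "t = X / Y ^ c"

text \<open>A function of residue 1 at infinity, where \<open>inverse Y\<close> vanishes. Its powers
  are the units in the normal forms of \<open>X\<close> and \<open>Y\<close> with respect to
  \<open>t\<close>.\<close>

definition \<eta> :: 'f where "\<eta> = 1 + inverse Y ^ (q - 1)"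

lemma t_nonzero: "t \<noteq> 0"
  using X_nonzero Y_nonzero by (simp add: t_def)

lemma coprime_q_m: "coprime q m"
  by (metis coprime_Suc_right_nat coprime_mult_right_iff mc Suc_eq_plus1)

text \<open>In the coordinates \<open>(t, 1/Y)\<close> the curve has the same equation, and its point at infinity is the
  origin, at which \<open>t\<close> is a uniformizer. In terms of valuations, \<open>v(X) = -q\<close> and \<open>v(Y) = -m\<close>.\<close>

lemma t_power_m: "t ^ m = inverse Y + inverse Y ^ q" and Y_t: "Y * t ^ m = \<eta>"
  and X_t: "X * t ^ q = \<eta> ^ c"
proof -
  have "(Y ^ c) ^ m = Y ^ (q + 1)" by (simp only: mult.commute[of c] mc flip: power_mult)
  then have "t ^ m = X ^ m / Y ^ (q + 1)" by (simp only: t_def power_divide)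
  also have "\<dots> = Y ^ q / Y ^ (q + 1) + Y / Y ^ (q + 1)"
    by (simp add: curve_eq[symmetric] add_divide_distrib)
  also have "\<dots> = inverse Y + inverse Y ^ q"
    using Y_nonzero by (simp add: field_simps power_inverse)
  finally show tm: "t ^ m = inverse Y + inverse Y ^ q" .
  have "inverse Y ^ q = inverse Y ^ (q - 1) * inverse Y"
    using power_minus_mult[of q "inverse Y"] q_ge by simp
  then show yt: "Y * t ^ m = \<eta>"
    unfolding tm \<eta>_def using Y_nonzero by (simp add: algebra_simps)
  have "X = t * Y ^ c" using Y_nonzero by (simp add: t_def)
  then have "X * t ^ q = t ^ (m * c) * Y ^ c" unfolding mc by simp
  also have "t ^ (m * c) = (t ^ m) ^ c" by (rule power_mult)
  also have "(t ^ m) ^ c * Y ^ c = (Y * t ^ m) ^ c" by (simp only: power_mult_distrib mult.commute)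
  finally show "X * t ^ q = \<eta> ^ c" unfolding yt .
qed

lemma monomial_t: "X ^ i * Y ^ j * t ^ (q * i + m * j) = \<eta> ^ (c * i + j)"
proof -
  have "t ^ (q * i + m * j) = (t ^ q) ^ i * (t ^ m) ^ j" by (simp only: power_mult power_add)
  then have "X ^ i * Y ^ j * t ^ (q * i + m * j) = (X * t ^ q) ^ i * (Y * t ^ m) ^ j"
    by (simp only: power_mult_distrib mult_ac)
  then show ?thesis by (simp only: X_t Y_t power_mult power_add)
qed

lemma at_infinityD:
  assumes "P \<in> at_infinity"
  shows "place \<iota> P" "X \<notin> P" "Y \<notin> P" "t \<in> max_ideal P" "\<eta> ^ n - \<iota> 1 \<in> max_ideal P"
    "inverse X \<in> max_ideal P" "Y / X \<in> max_ideal P"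
proof -
  show P: "place \<iota> P" and X: "X \<notin> P" using assms by (auto simp: at_infinity_def)
  note C = place_closed[OF P]
  show Y: "Y \<notin> P"
  proof
    assume "Y \<in> P"
    then have "X ^ m \<in> P" unfolding curve_eq[symmetric] by (intro C)
    then show False using power_in_placeD[OF P] X m_ge by auto
  qed
  have s: "inverse Y \<in> max_ideal P" by (rule inverse_in_max_ideal[OF P Y])
  have pow: "inverse Y ^ n \<in> max_ideal P" if "n > 0" for n
    using power_in_max_ideal[OF P s that] .
  have tm: "t ^ m \<in> max_ideal P"
    unfolding t_power_m using q_ge by (intro max_ideal_add[OF P] s pow) auto
  have "t \<in> P" by (rule power_in_placeD[OF P, of t m]) (use max_ideal_subset[OF P tm] m_ge in auto)
  then show t: "t \<in> max_ideal P" using power_in_max_idealD[OF P _ tm] by blast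
  have "\<eta> - \<iota> 1 \<in> max_ideal P" using pow[of "q - 1"] q_ge by (simp add: \<eta>_def)
  then show \<eta>: "\<eta> ^ n - \<iota> 1 \<in> max_ideal P" for n using residue_power[OF P, of \<eta> 1 n] by simp
  show "inverse X \<in> max_ideal P" by (rule inverse_in_max_ideal[OF P X])
  have "\<eta> ^ c \<noteq> 0" by (rule residue_unit(2)[OF P \<eta>]) simp
  \<comment> \<open>This product is \<open>Y / X\<close>, which has valuation
    \<open>q - m > 0\<close>.\<close>
  have "\<eta> * t ^ (q - m) * inverse (\<eta> ^ c) \<in> max_ideal P"
  proof (rule max_ideal_mult(1)[OF P max_ideal_mult(2)[OF P]])
    show "\<eta> \<in> P" using residue_in_place[OF P \<eta>[of 1]] by simp
    show "t ^ (q - m) \<in> max_ideal P" by (rule power_in_max_ideal[OF P t]) (use m_less in simp)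
    show "inverse (\<eta> ^ c) \<in> P" by (rule residue_unit(3)[OF P \<eta>]) simp
  qed
  moreover have "Y / X = \<eta> * t ^ (q - m) * inverse (\<eta> ^ c)"
  proof -
    have "Y * t ^ q = \<eta> * t ^ (q - m)"
      using m_less by (simp add: mult.assoc flip: Y_t power_add)
    then have "\<eta> * t ^ (q - m) * X = Y * \<eta> ^ c" by (simp add: mult_ac flip: X_t)
    then show ?thesis using X_nonzero \<open>\<eta> ^ c \<noteq> 0\<close> by (simp add: field_simps)
  qed
  ultimately show "Y / X \<in> max_ideal P" by simp
qed

definition monomials :: "'k poly poly \<Rightarrow> (nat \<times> nat) set" where
  "monomials p = {(i, j). coeff (coeff p j) i \<noteq> 0}"

lemma finite_monomials: "finite (monomials p)"
  and ev_monomials: "ev p = (\<Sum>(i, j)\<in>monomials p. \<iota> (coeff (coeff p j) i) * X ^ i * Y ^ j)"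
proof -
  let ?S = "SIGMA j:{..degree p}. {..degree (coeff p j)}"
  let ?M = "{(j, i). coeff (coeff p j) i \<noteq> 0}"
  have sub: "?M \<subseteq> ?S"
  proof clarify
    fix j i assume nz: "coeff (coeff p j) i \<noteq> 0"
    then have "coeff p j \<noteq> 0" by auto
    then show "j \<in> {..degree p} \<and> i \<in> {..degree (coeff p j)}" using nz by (simp add: le_degree)
  qed
  have mon: "monomials p = (\<lambda>(j, i). (i, j)) ` ?M" by (auto simp: monomials_def)
  have fin: "finite ?M" by (rule finite_subset[OF sub]) auto
  then show "finite (monomials p)" unfolding mon by (rule finite_imageI)
  have x: "evx a = (\<Sum>i\<le>degree a. \<iota> (coeff a i) * X ^ i)" for a
    by (simp add: poly_altdef degree_map_poly coeff_map_poly)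
  have "p = (\<Sum>j\<le>degree p. monom (coeff p j) j)" by (simp only: poly_as_sum_of_monoms)
  then have "ev p = ev (\<Sum>j\<le>degree p. monom (coeff p j) j)" by (rule arg_cong)
  also have "\<dots> = (\<Sum>j\<le>degree p. ev (monom (coeff p j) j))"
    by (rule eval2_sum)
  also have "\<dots> = (\<Sum>j\<le>degree p. \<Sum>i\<le>degree (coeff p j). \<iota> (coeff (coeff p j) i) * X ^ i * Y ^ j)"
    by (simp add: x sum_distrib_right)
  also have "\<dots> = (\<Sum>(j, i)\<in>?S. \<iota> (coeff (coeff p j) i) * X ^ i * Y ^ j)"
    by (rule sum.Sigma) auto
  also have "\<dots> = (\<Sum>(j, i)\<in>?M. \<iota> (coeff (coeff p j) i) * X ^ i * Y ^ j)"
    by (rule sum.mono_neutral_right) (use sub in auto)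
  also have "\<dots> = (\<Sum>(i, j)\<in>monomials p. \<iota> (coeff (coeff p j) i) * X ^ i * Y ^ j)"
    unfolding mon by (subst sum.reindex) (auto simp: inj_on_def case_prod_unfold)
  finally show "ev p = (\<Sum>(i, j)\<in>monomials p. \<iota> (coeff (coeff p j) i) * X ^ i * Y ^ j)" .
qed

text \<open>Modulo \<open>q\<close> only \<open>mj\<close> remains, and \<open>m\<close> is
  invertible there, so \<open>j\<close> is determined.\<close>

lemma weight_inj:
  assumes "q * i + m * j = q * i' + m * j'" "j < q" "j' < q"
  shows "i = i' \<and> j = j'"
proof -
  have "[m * j = m * j'] (mod q)"
    using assms(1) unfolding cong_def by (metis mod_mult_self4)
  then have "[j = j'] (mod q)" using coprime_q_m by (simp add: cong_mult_lcancel_nat coprime_commute)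
  then have "j = j'" using assms by (simp add: cong_less_modulus_unique_nat)
  then show ?thesis using assms by simp
qed

text \<open>The monomials \<open>X\<^sup>i Y\<^sup>j\<close> with \<open>j < q\<close> have distinct pole orders \<open>qi + mj\<close> at infinity.\<close>

lemma leading_term_at_infinity:
  assumes "p \<noteq> 0" "degree p < q"
  obtains n e where "e \<noteq> 0" "\<And>i j. coeff (coeff p j) i \<noteq> 0 \<Longrightarrow> q * i + m * j \<le> n"
    "\<And>P. P \<in> at_infinity \<Longrightarrow> ev p * t ^ n - \<iota> e \<in> max_ideal P"
proof -
  let ?w = "\<lambda>(i, j). q * i + m * j"
  let ?M = "monomials p"
  define n where "n = Max (?w ` ?M)"
  have "?M \<noteq> {}" using assms(1) by (auto simp: monomials_def poly_eq_iff)
  then have "n \<in> ?w ` ?M" unfolding n_def using finite_monomials by (intro Max_in) auto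
  then obtain i0 j0 where 0: "(i0, j0) \<in> ?M" "n = q * i0 + m * j0" by auto
  have le: "q * i + m * j \<le> n" if "(i, j) \<in> ?M" for i j
    unfolding n_def using that finite_monomials[of p] by (intro Max_ge) force+
  have j_less: "j < q" if "(i, j) \<in> ?M" for i j
  proof -
    have "coeff p j \<noteq> 0" using that by (auto simp: monomials_def)
    then show ?thesis using le_degree assms(2) by (metis le_less_trans)
  qed
  define e where "e = coeff (coeff p j0) i0"
  show ?thesis
  proof (rule that[of e n])
    show "e \<noteq> 0" using 0 by (simp add: e_def monomials_def)
    show "q * i + m * j \<le> n" if "coeff (coeff p j) i \<noteq> 0" for i j
      using le that by (simp add: monomials_def)
    fix P assume "P \<in> at_infinity"
    note I = at_infinityD[OF this]
    note C = place_closed[OF I(1)]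
    have "\<iota> e = (\<Sum>w\<in>?M. if w = (i0, j0) then \<iota> e else 0)"
      using 0(1) finite_monomials by simp
    then have "\<iota> e = (\<Sum>w\<in>?M. if fst w = i0 \<and> snd w = j0 then \<iota> e else 0)"
      by (simp only: prod_eq_iff fst_conv snd_conv)
    then have "ev p * t ^ n - \<iota> e = (\<Sum>(i, j)\<in>?M. \<iota> (coeff (coeff p j) i) * X ^ i * Y ^ j * t ^ n
        - (if (i, j) = (i0, j0) then \<iota> e else 0))"
      by (simp add: ev_monomials[of p] sum_distrib_right sum_subtractf case_prod_unfold)
    also have "\<dots> \<in> max_ideal P"
    proof (rule max_ideal_sum[OF I(1)], clarify)
      fix i j assume ij: "(i, j) \<in> ?M"
      have \<eta>P: "\<eta> ^ k \<in> P" for k by (rule residue_in_place[OF I(1) I(5)])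
      \<comment> \<open>Multiplied by \<open>t^n\<close>, a monomial of weight \<open>w\<close>
        becomes a constant times a function of residue 1 times \<open>t^(n - w)\<close>. Only the
        one monomial of maximal weight contributes to the residue.\<close>
      have "t ^ n = t ^ (q * i + m * j) * t ^ (n - (q * i + m * j))"
        using le[OF ij] by (simp flip: power_add)
      then have eq: "\<iota> (coeff (coeff p j) i) * X ^ i * Y ^ j * t ^ n =
          \<iota> (coeff (coeff p j) i) * \<eta> ^ (c * i + j) * t ^ (n - (q * i + m * j))"
        by (simp add: mult_ac flip: monomial_t)
      show "\<iota> (coeff (coeff p j) i) * X ^ i * Y ^ j * t ^ n
          - (if (i, j) = (i0, j0) then \<iota> e else 0) \<in> max_ideal P"
      proof (cases "(i, j) = (i0, j0)")
        case True
        have "\<iota> e * (\<eta> ^ (c * i + j) - \<iota> 1) \<in> max_ideal P"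
          by (intro max_ideal_mult(2)[OF I(1)] I iota_in_place)
        then show ?thesis unfolding eq using True by (simp add: e_def 0 algebra_simps)
      next
        case False
        then have "q * i + m * j \<noteq> n" using weight_inj j_less[OF ij] j_less[OF 0(1)] 0(2) by blast
        then have "n - (q * i + m * j) > 0" using le[OF ij] by simp
        then have "\<iota> (coeff (coeff p j) i) * \<eta> ^ (c * i + j) * t ^ (n - (q * i + m * j)) \<in> max_ideal P"
          by (intro max_ideal_mult(2)[OF I(1)] power_in_max_ideal[OF I(1)] I C iota_in_place[OF I(1)] \<eta>P)
        then show ?thesis unfolding eq if_not_P[OF False] by simp
      qed
    qed
    finally show "ev p * t ^ n - \<iota> e \<in> max_ideal P" .
  qed
qed

section \<open>Uniqueness and existence of the place at infinity\<close>

lemma at_infinity_unique: "P \<in> at_infinity \<Longrightarrow> Q \<in> at_infinity \<Longrightarrow> P = Q"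
  and at_infinity_rational: "P \<in> at_infinity \<Longrightarrow> P \<in> rational_points \<iota>"
proof -
  have 1: "place \<iota> P \<and> t \<in> max_ideal P" if "P \<in> at_infinity" for P
    using at_infinityD[OF that] by simp
  have 2: "\<exists>k n u. has_unit_residue at_infinity u \<and> f * t ^ k = u * t ^ n" if "f \<noteq> 0" for f
  proof -
    obtain p a where p: "degree p < q" "a \<noteq> 0" "f = ev p / evx a" by (rule standard_fraction)
    have "p \<noteq> 0" using that p by auto
    have q0: "degree [:a:] < q" "[:a:] \<noteq> 0" using q_ge p(2) by auto
    obtain n1 e1 where 1: "e1 \<noteq> 0" "\<And>P. P \<in> at_infinity \<Longrightarrow> ev p * t ^ n1 - \<iota> e1 \<in> max_ideal P"
      using leading_term_at_infinity[OF \<open>p \<noteq> 0\<close> p(1)] by metis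
    obtain n2 e2 where 2: "e2 \<noteq> 0" "\<And>P. P \<in> at_infinity \<Longrightarrow> ev [:a:] * t ^ n2 - \<iota> e2 \<in> max_ideal P"
      using leading_term_at_infinity[OF q0(2,1)] by metis
    define u where "u = (ev p * t ^ n1) * inverse (evx a * t ^ n2)"
    have "has_unit_residue at_infinity (ev p * t ^ n1)"
      and "has_unit_residue at_infinity (evx a * t ^ n2)"
      unfolding has_unit_residue_def using 1 2 by auto
    then have "has_unit_residue at_infinity u"
      unfolding u_def
      using has_unit_residue_mult[OF at_infinityD(1)] has_unit_residue_inverse[OF at_infinityD(1)]
      by blast
    moreover have "f * t ^ n1 = u * t ^ n2"
      using p(2) t_nonzero by (simp add: u_def p(3) field_simps)
    ultimately show ?thesis by blast
  qed
  show "P \<in> at_infinity \<Longrightarrow> Q \<in> at_infinity \<Longrightarrow> P = Q"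
    and "P \<in> at_infinity \<Longrightarrow> P \<in> rational_points \<iota>"
    by (rule places_with_common_uniformizer[OF 1 t_nonzero 2]; assumption)+
qed

lemma subring_of_range_iota: "subring_of (range \<iota>)"
  unfolding subring_of_def
proof (intro conjI ballI)
  show "1 \<in> range \<iota>" using iota_simps(1) by (metis rangeI)
  fix x y assume "x \<in> range \<iota>" "y \<in> range \<iota>"
  then obtain a b where "x = \<iota> a" "y = \<iota> b" by blast
  then have "x - y = \<iota> (a - b)" "x * y = \<iota> (a * b)" by simp_all
  then show "x - y \<in> range \<iota>" "x * y \<in> range \<iota>" by blast+
qed

text \<open>\<open>X\<close> is transcendental over \<open>k\<close>, so \<open>1/X\<close> is not
  invertible in \<open>k[1/X]\<close>, and \<open>ex_place\<close> yields a place that contains this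
  ring but not \<open>X\<close>.\<close>

lemma ex_at_infinity: "\<exists>P. P \<in> at_infinity"
proof -
  let ?A = "adjoin (range \<iota>) (inverse X)"
  note A = subring_of_adjoin[OF subring_of_range_iota, of "inverse X"]
  have "X \<notin> ?A"
  proof
    assume "X \<in> ?A"
    then obtain n a where a: "\<And>i. a i \<in> range \<iota>" "X = (\<Sum>i\<le>n. a i * inverse X ^ i)"
      using adjoin_sum[OF _ subring_of_range_iota] by metis
    have "\<exists>e. a i = \<iota> e" for i using a(1)[of i] by (rule imageE) blast
    then obtain b where b: "\<And>i. a i = \<iota> (b i)" by metis
    define r where "r = (\<Sum>i\<le>n. monom (b i) (n - i))"
    have sum: "evx (\<Sum>i\<in>I. f i) = (\<Sum>i\<in>I. evx (f i))" if "finite I" for f and I :: "nat set"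
      using that by (induction I) auto
    have "X ^ Suc n = X * X ^ n" by simp
    also have "\<dots> = (\<Sum>i\<le>n. \<iota> (b i) * inverse X ^ i) * X ^ n" by (subst a(2)) (simp only: b)
    also have "\<dots> = (\<Sum>i\<le>n. \<iota> (b i) * X ^ (n - i))"
      unfolding sum_distrib_right
    proof (rule sum.cong[OF refl], goal_cases)
      case (1 i)
      then have "X ^ n = X ^ (n - i) * X ^ i" by (simp flip: power_add)
      then show ?case using X_nonzero by (simp add: power_inverse)
    qed
    also have "\<dots> = evx r" by (simp add: r_def sum poly_monom)
    finally have "evx (monom 1 (Suc n) - r) = 0" by (simp add: poly_monom)
    then have "monom 1 (Suc n) - r = 0" by (simp only: evx_eq_0_iff)
    then have "monom 1 (Suc n) = r" by simp
    moreover have "coeff r (Suc n) = 0" by (auto simp: r_def coeff_sum intro!: sum.neutral)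
    ultimately show False by (metis coeff_monom zero_neq_one)
  qed
  then have "inverse (inverse X) \<notin> ?A" by simp
  then obtain P where "place \<iota> P" "inverse (inverse X) \<notin> P"
    using ex_place[OF emb A(1,2,3)] by metis
  then show ?thesis by (auto simp: at_infinity_def)
qed

text \<open>No cancellation occurs among the monomials, so the pole order \<open>n\<close> of
  \<open>ev p\<close> is the largest of their weights. As \<open>X^d\<close> has pole order
  \<open>qd\<close>, regularity of the quotient bounds each monomial separately.\<close>

lemma pole_order_bound:
  assumes P: "P \<in> at_infinity" and p: "degree p < q" and reg: "ev p / X ^ d \<in> P"
    and nz: "coeff (coeff p j) i \<noteq> 0"
  shows "q * i + m * j \<le> q * d"
proof -
  note I = at_infinityD[OF P]
  have "p \<noteq> 0" using nz by auto
  then obtain n e where n: "e \<noteq> 0" "\<And>i j. coeff (coeff p j) i \<noteq> 0 \<Longrightarrow> q * i + m * j \<le> n"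
    "\<And>P. P \<in> at_infinity \<Longrightarrow> ev p * t ^ n - \<iota> e \<in> max_ideal P"
    using leading_term_at_infinity[OF _ p] by metis
  let ?u = "(ev p * t ^ n) * inverse (\<eta> ^ (c * d))"
  have "?u - \<iota> (e * inverse 1) \<in> max_ideal P"
    by (intro residue_mult[OF I(1)] n P residue_unit(4)[OF I(1)] I) simp
  moreover have "ev p / X ^ d * t ^ n = ?u * t ^ (q * d)"
  proof -
    have "X ^ d * t ^ (q * d) = \<eta> ^ (c * d)" using monomial_t[of d 0] by simp
    moreover have "\<eta> ^ (c * d) \<noteq> 0" by (rule residue_unit(2)[OF I(1) I(5)]) simp
    ultimately show ?thesis using X_nonzero by (simp add: field_simps)
  qed
  ultimately have "n \<le> q * d"
    using uniformizer_normal_form(1)[OF I(1,4) t_nonzero] n(1) reg by fastforce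
  then show ?thesis using n(2)[OF nz] by simp
qed

end

section \<open>Global sections\<close>

lemma ex_irreducible_factor:
  fixes a :: "'a::field poly"
  assumes "degree a > 0"
  obtains \<pi> where "irreducible \<pi>" "\<pi> dvd a"
proof -
  define \<pi> where "\<pi> = arg_min degree (\<lambda>p. p dvd a \<and> degree p > 0)"
  have \<pi>: "\<pi> dvd a \<and> degree \<pi> > 0"
    unfolding \<pi>_def by (rule arg_min_natI[of _ a]) (use assms in auto)
  have min: "degree \<pi> \<le> degree p" if "p dvd a" "degree p > 0" for p
    unfolding \<pi>_def by (rule arg_min_nat_le) (use that in auto)
  have "irreducible \<pi>"
  proof (rule irreducibleI)
    show \<pi>0: "\<pi> \<noteq> 0" using \<pi> by auto
    show "\<not> \<pi> dvd 1" using \<pi> is_unit_iff_degree[OF \<pi>0] by auto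
    fix r s assume rs: "\<pi> = r * s"
    then have nz: "r \<noteq> 0" "s \<noteq> 0" using \<pi>0 by auto
    have "r dvd a" "s dvd a" using \<pi> rs by (auto dest: dvd_mult_left dvd_mult_right)
    then have "degree r = 0 \<or> degree s = 0"
      using min[of r] min[of s] nz by (auto simp: rs degree_mult_eq)
    then show "r dvd 1 \<or> s dvd 1" using nz by (auto simp: is_unit_iff_degree)
  qed
  then show ?thesis using that \<pi> by blast
qed

context maximal_curve
begin

lemma subring_of_range_ev: "subring_of (range ev)"
  unfolding subring_of_def
proof (intro conjI ballI)
  show "1 \<in> range ev" using eval2_simps(2) by (metis rangeI)
  fix x y assume "x \<in> range ev" "y \<in> range ev"
  then obtain p r where "x = ev p" "y = ev r" by blast
  then have "x - y = ev (p - r)" "x * y = ev (p * r)" by simp_all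
  then show "x - y \<in> range ev" "x * y \<in> range ev" by blast+
qed

text \<open>Write \<open>f\<close> as a fraction \<open>p/a\<close> with \<open>a\<close> in \<open>k[x]\<close> of least degree. Since \<open>f\<close> is integral over
  \<open>k[X, Y]\<close>, some power of \<open>p\<close> is divisible by each irreducible factor of \<open>a\<close>, hence so is \<open>p\<close>.\<close>

lemma regular_imp_polynomial:
  assumes reg: "\<And>P. place \<iota> P \<Longrightarrow> X \<in> P \<Longrightarrow> f \<in> P"
  obtains p where "degree p < q" "f = ev p"
proof (cases "f = 0")
  case True
  then show ?thesis using that[of 0] q_ge by simp
next
  case False
  define good where "good a \<longleftrightarrow> a \<noteq> 0 \<and> (\<exists>p. degree p < q \<and> f = ev p / evx a)" for a
  define a where "a = arg_min degree good"
  obtain p0 a0 where "degree p0 < q" "a0 \<noteq> 0" "f = ev p0 / evx a0" by (rule standard_fraction)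
  then have "good a0" unfolding good_def by blast
  then have "good a" unfolding a_def by (rule arg_min_natI)
  have min: "degree a \<le> degree b" if "good b" for b
    unfolding a_def by (rule arg_min_nat_le) (rule that)
  obtain p where a0: "a \<noteq> 0" and p: "degree p < q" "f = ev p / evx a"
    using \<open>good a\<close> unfolding good_def by blast
  have fa: "f * evx a = ev p" using a0 p by simp
  have "degree a = 0"
  proof (rule ccontr)
    assume "degree a \<noteq> 0"
    then obtain \<pi> where \<pi>: "irreducible \<pi>" "\<pi> dvd a" using ex_irreducible_factor[of a] by blast
    obtain a' where a': "a = \<pi> * a'" using \<pi>(2) by (elim dvdE)
    \<comment> \<open>If \<open>f\<close> were not in \<open>k[X, Y][1/f]\<close>, some place would
      contain this ring, in particular \<open>X\<close>, but not \<open>f\<close>. An expression of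
      \<open>f\<close> in this ring, multiplied by \<open>f^n\<close>, is an integral equation for
      \<open>f\<close> of degree \<open>n + 1\<close>.\<close>
    let ?A = "adjoin (range ev) (inverse f)"
    note A = subring_of_adjoin[OF subring_of_range_ev, of "inverse f"]
    have "f \<in> ?A"
    proof (rule ccontr)
      assume "f \<notin> ?A"
      then have "inverse (inverse f) \<notin> ?A" by simp
      moreover have "\<iota> e \<in> ?A" for e
        using A(2) rangeI[of ev "[:[:e:]:]"] by (auto simp: poly_monom)
      then have "range \<iota> \<subseteq> ?A" by blast
      ultimately obtain P where P: "place \<iota> P" "?A \<subseteq> P" "inverse (inverse f) \<notin> P"
        using ex_place[OF emb A(1) _ A(3)] by metis
      have "X \<in> range ev" using rangeI[of ev "[:[:0, 1:]:]"] by simp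
      then have "X \<in> P" using A(2) P(2) by blast
      then show False using reg[OF P(1)] P(3) by simp
    qed
    then obtain n b where b: "\<And>i. b i \<in> range ev" "f = (\<Sum>i\<le>n. b i * inverse f ^ i)"
      using adjoin_sum[OF _ subring_of_range_ev] by metis
    have "\<exists>r. b i = ev r" for i using b(1)[of i] by (rule imageE) blast
    then obtain r where r: "\<And>i. b i = ev (r i)" by metis
    \<comment> \<open>Multiplying the integral equation by \<open>a^(n + 1)\<close> turns it into
      \<open>p^(n + 1) = a h\<close>.\<close>
    define h where "h = (\<Sum>i\<le>n. r i * p ^ (n - i) * [:a:] ^ i)"
    have "f ^ Suc n = (\<Sum>i\<le>n. ev (r i) * inverse f ^ i) * f ^ n"
      using b(2) r by simp
    also have "\<dots> = (\<Sum>i\<le>n. ev (r i) * f ^ (n - i))"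
      unfolding sum_distrib_right
    proof (rule sum.cong[OF refl], goal_cases)
      case (1 i)
      then have "f ^ n = f ^ (n - i) * f ^ i" by (simp flip: power_add)
      then show ?case using False by (simp add: power_inverse)
    qed
    finally have "f ^ Suc n * evx a ^ Suc n = (\<Sum>i\<le>n. ev (r i) * f ^ (n - i)) * evx a ^ n * evx a"
      by (simp only: power_Suc mult_ac)
    also have "(\<Sum>i\<le>n. ev (r i) * f ^ (n - i)) * evx a ^ n = ev h"
      unfolding sum_distrib_right h_def eval2_sum
    proof (rule sum.cong[OF refl], goal_cases)
      case (1 i)
      then have "evx a ^ n = evx a ^ (n - i) * evx a ^ i" by (simp flip: power_add)
      then show ?case by (simp add: power_mult_distrib mult_ac flip: fa)
    qed
    finally have "ev p ^ Suc n = evx \<pi> * ev (h * [:a':])"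
      unfolding fa[symmetric] power_mult_distrib by (simp add: a' mult_ac)
    from dvd_of_power_dvd[OF field_poly_irreducible_imp_prime[OF \<pi>(1)] p(1) this]
    obtain p' where p': "p = [:\<pi>:] * p'" by (elim dvdE)
    have nz: "\<pi> \<noteq> 0" "a' \<noteq> 0" using a0 a' by auto
    have "degree p' = degree p" using nz by (simp add: p')
    moreover have "f = ev p' / evx a'" using nz p(2) by (simp add: p' a')
    ultimately have "good a'" using nz(2) p(1) unfolding good_def by metis
    then have "degree a \<le> degree a'" by (rule min)
    moreover have "degree \<pi> > 0"
      using \<pi>(1) nz is_unit_iff_degree[OF nz(1)] by (auto simp: irreducible_def)
    ultimately show False using nz by (simp add: a' degree_mult_eq)
  qed
  then obtain e where e: "a = [:e:]" by (rule degree_eq_zeroE)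
  then have "e \<noteq> 0" using a0 by simp
  then have "f = inverse (\<iota> e) * ev p" using fa by (simp add: e field_simps)
  then have "f = ev (smult [:inverse e:] p)" by simp
  moreover have "degree (smult [:inverse e:] p) < q"
    using p(1) degree_smult_le le_less_trans by blast
  ultimately show ?thesis using that by blast
qed

text \<open>Divided by \<open>Y^q\<close>, the curve equation reads
  \<open>X^m / Y^q = 1 + 1 / Y^(q - 1)\<close>. If \<open>Y\<close> had a pole and \<open>X\<close>
  none, this would reduce to \<open>0 = 1\<close>.\<close>

lemma Y_in_place:
  assumes P: "place \<iota> P" and X: "X \<in> P"
  shows "Y \<in> P"
proof (rule ccontr)
  assume "Y \<notin> P"
  note s = inverse_in_max_ideal[OF P this]
  have "X ^ m * inverse Y ^ q \<in> max_ideal P"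
    using q_ge by (intro max_ideal_mult(2)[OF P] power_in_max_ideal[OF P s] place_closed[OF P] X) simp
  also have "X ^ m * inverse Y ^ q = 1 + inverse Y ^ (q - 1)"
  proof -
    have "Y * inverse Y ^ q = inverse Y ^ (q - 1)"
      using power_minus_mult[of q "inverse Y", symmetric] q_ge Y_nonzero by simp
    then show ?thesis
      using Y_nonzero by (simp add: distrib_right power_inverse flip: curve_eq)
  qed
  finally have "1 + inverse Y ^ (q - 1) - inverse Y ^ (q - 1) \<in> max_ideal P"
    using q_ge by (intro max_ideal_diff[OF P] power_in_max_ideal[OF P s]) simp_all
  then show False using one_notin_max_ideal[OF P] by simp
qed

lemma coord_scale_affine:
  assumes P: "place \<iota> P" and X: "X \<in> P"
  shows "coord_scale X Y P u \<longleftrightarrow> u \<in> P \<and> u \<notin> max_ideal P"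
  using max_ideal_mult(1)[OF P _ X, of u] max_ideal_mult(1)[OF P _ Y_in_place[OF P X], of u]
    place_closed(4)[OF P _ X, of u] place_closed(4)[OF P _ Y_in_place[OF P X], of u]
  unfolding coord_scale_def by blast

lemma coord_scale_infinite:
  assumes "P \<in> at_infinity"
  shows "coord_scale X Y P u \<longleftrightarrow> u * X \<in> P \<and> u * X \<notin> max_ideal P"
proof -
  note I = at_infinityD[OF assms]
  have u: "u = u * X * inverse X" "u * Y = u * X * (Y / X)" using X_nonzero by simp_all
  have "u \<in> max_ideal P" "u * Y \<in> max_ideal P" if "u * X \<in> P"
    using max_ideal_mult(2)[OF I(1) I(6) that] max_ideal_mult(2)[OF I(1) I(7) that] u by simp_all
  then show ?thesis using max_ideal_subset[OF I(1)] unfolding coord_scale_def by blast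
qed

text \<open>The scaling factors are the units at a finite place, and the units times
  \<open>1/X\<close> at infinity. Units do not affect the condition, so \<open>1\<close> and
  \<open>1/X\<close> can stand for all of them.\<close>

lemma global_sections_iff:
  "f \<in> global_sections \<iota> X Y d \<longleftrightarrow>
    (\<forall>P. place \<iota> P \<longrightarrow> (if X \<in> P then f \<in> P else f / X ^ d \<in> P))"
proof -
  have "(\<exists>u. coord_scale X Y P u \<and> f * u ^ d \<in> P) \<longleftrightarrow> (if X \<in> P then f \<in> P else f / X ^ d \<in> P)"
    if P: "place \<iota> P" for P
  proof (cases "X \<in> P")
    case True
    have "f \<in> P" if "u \<in> P" "u \<notin> max_ideal P" "f * u ^ d \<in> P" for u
    proof -
      note U = place_unit[OF P that(1,2)]
      have "f * u ^ d * inverse u ^ d \<in> P" by (intro place_closed[OF P] that U)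
      also have "f * u ^ d * inverse u ^ d = f" using U by (simp add: power_inverse)
      finally show ?thesis .
    qed
    moreover have "1 \<in> P \<and> 1 \<notin> max_ideal P" using place_closed(1)[OF P] one_notin_max_ideal[OF P] by blast
    ultimately show ?thesis
      using True unfolding coord_scale_affine[OF P True] by (metis mult_1_right power_one)
  next
    case False
    then have I: "P \<in> at_infinity" using P by (simp add: at_infinity_def)
    have "f / X ^ d \<in> P" if "u * X \<in> P" "u * X \<notin> max_ideal P" "f * u ^ d \<in> P" for u
    proof -
      note U = place_unit[OF P that(1,2)]
      have "f * u ^ d * inverse (u * X) ^ d \<in> P" by (intro place_closed[OF P] that U)
      also have "f * u ^ d * inverse (u * X) ^ d = f / X ^ d"
        using U by (simp add: power_inverse divide_inverse power_mult_distrib)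
      finally show ?thesis .
    qed
    moreover have "inverse X * X \<in> P \<and> inverse X * X \<notin> max_ideal P"
      using place_closed(1)[OF P] one_notin_max_ideal[OF P] X_nonzero by simp
    moreover have "f * inverse X ^ d = f / X ^ d" by (simp add: divide_inverse power_inverse)
    ultimately show ?thesis
      using False unfolding coord_scale_infinite[OF I] by metis
  qed
  then show ?thesis unfolding global_sections_def by blast
qed

lemma global_section_polynomial:
  assumes "f \<in> global_sections \<iota> X Y d"
  obtains p where "f = ev p" "\<And>i j. coeff (coeff p j) i \<noteq> 0 \<Longrightarrow> q * i + m * j \<le> q * d"
proof -
  have f: "if X \<in> P then f \<in> P else f / X ^ d \<in> P" if "place \<iota> P" for P
    using assms that unfolding global_sections_iff by blast
  obtain p where p: "degree p < q" "f = ev p"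
  proof (rule regular_imp_polynomial[of f])
    show "f \<in> P" if "place \<iota> P" "X \<in> P" for P using f[OF that(1)] that(2) by simp
  qed
  obtain P where P: "P \<in> at_infinity" using ex_at_infinity by blast
  then have "ev p / X ^ d \<in> P" using f[of P] p(2) by (simp add: at_infinity_def)
  then show ?thesis using that[of p] p pole_order_bound[OF P p(1)] by blast
qed

lemma global_sections_mult:
  assumes "f \<in> global_sections \<iota> X Y d" "h \<in> global_sections \<iota> X Y e"
  shows "f * h \<in> global_sections \<iota> X Y (d + e)"
  unfolding global_sections_iff
proof (intro allI impI)
  fix P assume P: "place \<iota> P"
  have fh: "if X \<in> P then f \<in> P else f / X ^ d \<in> P" "if X \<in> P then h \<in> P else h / X ^ e \<in> P"
    using assms P unfolding global_sections_iff by blast+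
  show "if X \<in> P then f * h \<in> P else f * h / X ^ (d + e) \<in> P"
  proof (cases "X \<in> P")
    case True
    then show ?thesis using fh place_closed(4)[OF P] by simp
  next
    case False
    have "f * h / X ^ (d + e) = f / X ^ d * (h / X ^ e)" by (simp add: power_add)
    moreover have "f / X ^ d * (h / X ^ e) \<in> P"
      using False fh by (intro place_closed(4)[OF P]) simp_all
    ultimately have "f * h / X ^ (d + e) \<in> P" by (simp only:)
    then show ?thesis using False by simp
  qed
qed

lemma one_global_section: "1 \<in> global_sections \<iota> X Y d"
  unfolding global_sections_iff
proof (intro allI impI)
  fix P assume P: "place \<iota> P"
  show "if X \<in> P then 1 \<in> P else 1 / X ^ d \<in> P"
  proof (cases "X \<in> P")
    case True
    then show ?thesis using place_closed(1)[OF P] by simp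
  next
    case False
    then have "inverse X \<in> P" by (rule placeD(3)[OF P])
    then have "inverse X ^ d \<in> P" by (rule place_closed(7)[OF P])
    then show ?thesis using False by (simp add: divide_inverse power_inverse)
  qed
qed

text \<open>The valuation is \<open>q - 2m\<close>, nonnegative by \<open>two_m_le\<close>.
  Therefore a product of two horizontal lines has only the pole order of a single linear
  section.\<close>

lemma Y2_over_X: "P \<in> at_infinity \<Longrightarrow> Y ^ 2 / X \<in> P"
proof -
  assume "P \<in> at_infinity"
  note I = at_infinityD[OF this]
  have nz: "\<eta> ^ c \<noteq> 0" by (rule residue_unit(2)[OF I(1) I(5)]) simp
  have "\<eta> ^ 2 * t ^ (q - 2 * m) * inverse (\<eta> ^ c) \<in> P"
    by (intro place_closed[OF I(1)] residue_in_place[OF I(1) I(5)] residue_unit(3)[OF I(1) I(5)]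
        max_ideal_subset[OF I(1) I(4)]) simp
  moreover have "Y ^ 2 / X = \<eta> ^ 2 * t ^ (q - 2 * m) * inverse (\<eta> ^ c)"
  proof -
    have "Y ^ 2 * t ^ (m * 2) = \<eta> ^ 2" by (simp add: power_mult_distrib power_mult flip: Y_t)
    moreover have "t ^ q = t ^ (m * 2) * t ^ (q - 2 * m)"
      using two_m_le by (simp flip: power_add)
    ultimately have "Y ^ 2 * t ^ q = \<eta> ^ 2 * t ^ (q - 2 * m)" by (simp add: mult_ac)
    then have "\<eta> ^ 2 * t ^ (q - 2 * m) * X = Y ^ 2 * \<eta> ^ c" by (simp add: mult_ac flip: X_t)
    then show ?thesis using X_nonzero nz by (simp add: field_simps)
  qed
  ultimately show ?thesis by simp
qed

lemma linear_global_sections: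
  "X - \<iota> a \<in> global_sections \<iota> X Y 1" "Y - \<iota> b \<in> global_sections \<iota> X Y 1"
  "(Y - \<iota> b) * (Y - \<iota> b') \<in> global_sections \<iota> X Y 1"
proof -
  have at_inf: "X \<notin> P \<Longrightarrow> place \<iota> P \<Longrightarrow> (X - \<iota> a) / X \<in> P \<and> (Y - \<iota> b) / X \<in> P
      \<and> ((Y - \<iota> b) * (Y - \<iota> b')) / X \<in> P" for P
  proof -
    assume P: "place \<iota> P" "X \<notin> P"
    then have "P \<in> at_infinity" by (simp add: at_infinity_def)
    note I = at_infinityD[OF this]
    note Y2 = Y2_over_X[OF \<open>P \<in> at_infinity\<close>]
    note C = place_closed(1,3,4,6)[OF P(1)] iota_in_place[OF P(1)]
    have i: "inverse X \<in> P" and y: "Y / X \<in> P" using I max_ideal_subset[OF P(1)] by blast+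
    have "1 - \<iota> a * inverse X \<in> P" "Y / X - \<iota> b * inverse X \<in> P"
      "Y ^ 2 / X - (\<iota> b + \<iota> b') * (Y / X) + \<iota> b * \<iota> b' * inverse X \<in> P"
      by (intro C i y Y2)+
    moreover have "1 - \<iota> a * inverse X = (X - \<iota> a) / X" "Y / X - \<iota> b * inverse X = (Y - \<iota> b) / X"
      "Y ^ 2 / X - (\<iota> b + \<iota> b') * (Y / X) + \<iota> b * \<iota> b' * inverse X = ((Y - \<iota> b) * (Y - \<iota> b')) / X"
      using X_nonzero by (simp_all add: field_simps power2_eq_square)
    ultimately show ?thesis by metis
  qed
  have "X - \<iota> a \<in> P \<and> Y - \<iota> b \<in> P \<and> (Y - \<iota> b) * (Y - \<iota> b') \<in> P" if "place \<iota> P" "X \<in> P" for P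
    using that Y_in_place[OF that] by (intro conjI place_closed[OF that(1)] iota_in_place[OF that(1)])
  then show "X - \<iota> a \<in> global_sections \<iota> X Y 1" "Y - \<iota> b \<in> global_sections \<iota> X Y 1"
    "(Y - \<iota> b) * (Y - \<iota> b') \<in> global_sections \<iota> X Y 1"
    unfolding global_sections_iff using at_inf by simp_all
qed

end

section \<open>Rational points\<close>

context maximal_curve
begin

lemma centered_nonempty_imp_on_curve:
  assumes "P \<in> centered a b"
  shows "b ^ q + b = a ^ m"
proof -
  have P: "place \<iota> P" "X - \<iota> a \<in> max_ideal P" "Y - \<iota> b \<in> max_ideal P"
    using assms by (auto simp: centered_def)
  have "Y ^ q + Y - \<iota> (b ^ q + b) \<in> max_ideal P"
    by (intro residue_add[OF P(1)] residue_power[OF P(1)] P)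
  moreover have "X ^ m - \<iota> (a ^ m) \<in> max_ideal P"
    by (intro residue_power[OF P(1)] P)
  ultimately show ?thesis using residue_unique[OF P(1)] unfolding curve_eq by blast
qed

lemma rational_place_cases:
  assumes "P \<in> rational_points \<iota>"
  obtains "P \<in> at_infinity" | a b where "P \<in> centered a b"
proof (cases "X \<in> P")
  case True
  have P: "place \<iota> P" and res: "\<And>f. f \<in> P \<Longrightarrow> \<exists>a. f - \<iota> a \<in> max_ideal P"
    using assms by (auto simp: rational_points_def)
  obtain a b where "X - \<iota> a \<in> max_ideal P" "Y - \<iota> b \<in> max_ideal P"
    using res[OF True] res[OF Y_in_place[OF P True]] by blast
  then show ?thesis using that(2) P by (auto simp: centered_def)
next
  case False
  then show ?thesis using that(1) assms by (auto simp: rational_points_def at_infinity_def)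
qed

lemma normalization_map_centered:
  assumes "P \<in> centered a b"
  shows "normalization_map \<iota> X Y P = proj_point a b 1"
proof -
  have P: "place \<iota> P" and X: "X - \<iota> a \<in> max_ideal P" and Y: "Y - \<iota> b \<in> max_ideal P"
    using assms by (auto simp: centered_def)
  have "P \<in> rational_points \<iota>"
    using centered_rational[OF centered_nonempty_imp_on_curve] assms by blast
  then have res: "\<exists>e. f - \<iota> e \<in> max_ideal P" if "f \<in> P" for f
    using that by (auto simp: rational_points_def)
  note cs = coord_scale_affine[OF P residue_in_place[OF P X]]
  have val: "(value_at \<iota> P (u * X), value_at \<iota> P (u * Y), value_at \<iota> P u) = (s * a, s * b, s * 1)"
    if "u - \<iota> s \<in> max_ideal P" for u s
    using value_at_eqI[OF P residue_mult[OF P that X]] value_at_eqI[OF P residue_mult[OF P that Y]]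
      value_at_eqI[OF P that] by simp
  show ?thesis
    unfolding normalization_map_def proj_point_def cs
  proof (intro equalityI subsetI; elim CollectE exE conjE)
    fix x u assume x: "x = (value_at \<iota> P (u * X), value_at \<iota> P (u * Y), value_at \<iota> P u)"
      and u: "u \<in> P" "u \<notin> max_ideal P"
    obtain s where s: "u - \<iota> s \<in> max_ideal P" using res[OF u(1)] by blast
    then have "s \<noteq> 0" using u(2) by auto
    then show "x \<in> {(s * a, s * b, s * 1) |s. s \<noteq> 0}" using val[OF s] x by blast
  next
    fix x s assume x: "x = (s * a, s * b, s * 1)" and s: "s \<noteq> 0"
    have "\<iota> s \<in> P \<and> \<iota> s \<notin> max_ideal P"
      using s iota_in_place[OF P] iota_in_max_ideal_iff[OF P] by blast
    moreover have "x = (value_at \<iota> P (\<iota> s * X), value_at \<iota> P (\<iota> s * Y), value_at \<iota> P (\<iota> s))"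
      unfolding x val[OF residue_iota[OF P]] ..
    ultimately show "x \<in> {(value_at \<iota> P (u * X), value_at \<iota> P (u * Y), value_at \<iota> P u) |u.
        u \<in> P \<and> u \<notin> max_ideal P}" by blast
  qed
qed

lemma normalization_map_at_infinity:
  assumes "P \<in> at_infinity"
  shows "normalization_map \<iota> X Y P = proj_point 1 0 0"
proof -
  note I = at_infinityD[OF assms]
  have res: "\<exists>e. f - \<iota> e \<in> max_ideal P" if "f \<in> P" for f
    using at_infinity_rational[OF assms] that by (auto simp: rational_points_def)
  note cs = coord_scale_infinite[OF assms]
  have val: "(value_at \<iota> P (u * X), value_at \<iota> P (u * Y), value_at \<iota> P u) = (s * 1, s * 0, s * 0)"
    if u: "u * X - \<iota> s \<in> max_ideal P" for u s
  proof -
    have uX: "u * X \<in> P" by (rule residue_in_place[OF I(1) u])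
    have "u * X * (Y / X) - \<iota> 0 \<in> max_ideal P" "u * X * inverse X - \<iota> 0 \<in> max_ideal P"
      using max_ideal_mult(2)[OF I(1) I(7) uX] max_ideal_mult(2)[OF I(1) I(6) uX]
      by (simp_all only: iota_simps diff_zero)
    moreover have "u * X * (Y / X) = u * Y" "u * X * inverse X = u" using X_nonzero by simp_all
    ultimately have "u * Y - \<iota> 0 \<in> max_ideal P" "u - \<iota> 0 \<in> max_ideal P" by simp_all
    then show ?thesis
      using value_at_eqI[OF I(1) u] value_at_eqI[OF I(1), of "u * Y" 0] value_at_eqI[OF I(1), of u 0]
      by simp
  qed
  show ?thesis
    unfolding normalization_map_def proj_point_def cs
  proof (intro equalityI subsetI; elim CollectE exE conjE)
    fix x u assume x: "x = (value_at \<iota> P (u * X), value_at \<iota> P (u * Y), value_at \<iota> P u)"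
      and u: "u * X \<in> P" "u * X \<notin> max_ideal P"
    obtain s where s: "u * X - \<iota> s \<in> max_ideal P" using res[OF u(1)] by blast
    then have "s \<noteq> 0" using u(2) by auto
    then show "x \<in> {(s * 1, s * 0, s * 0) |s. s \<noteq> 0}" using val[OF s] x by blast
  next
    fix x s assume x: "x = (s * 1, s * 0, s * 0)" and s: "s \<noteq> (0 :: 'k)"
    have sX: "\<iota> s * inverse X * X = \<iota> s" using X_nonzero by simp
    have "\<iota> s * inverse X * X \<in> P \<and> \<iota> s * inverse X * X \<notin> max_ideal P"
      unfolding sX using s iota_in_place[OF I(1)] iota_in_max_ideal_iff[OF I(1)] by blast
    moreover have "x = (value_at \<iota> P (\<iota> s * inverse X * X), value_at \<iota> P (\<iota> s * inverse X * Y),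
        value_at \<iota> P (\<iota> s * inverse X))"
      unfolding x by (rule val[symmetric]) (simp only: sX residue_iota[OF I(1)])
    ultimately show "x \<in> {(value_at \<iota> P (u * X), value_at \<iota> P (u * Y), value_at \<iota> P u) |u.
        u * X \<in> P \<and> u * X \<notin> max_ideal P}" by blast
  qed
qed

lemma proj_point_affine_eq_iff: "proj_point a b 1 = proj_point a' b' 1 \<longleftrightarrow> a = a' \<and> b = b'"
proof
  assume "proj_point a b 1 = proj_point a' b' 1"
  moreover have "(a, b, 1) \<in> proj_point a b 1"
    unfolding proj_point_def by (intro CollectI exI[of _ 1]) simp
  ultimately show "a = a' \<and> b = b'" by (auto simp: proj_point_def)
qed simp

lemma proj_point_affine_neq_infinity: "proj_point a b 1 \<noteq> proj_point 1 0 (0 :: 'a::field)"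
proof
  assume "proj_point a b 1 = proj_point 1 0 (0 :: 'a)"
  moreover have "(a, b, 1) \<in> proj_point a b 1"
    unfolding proj_point_def by (intro CollectI exI[of _ 1]) simp
  ultimately show False by (auto simp: proj_point_def)
qed

lemma horizontal_line_affine_iff: "proj_point a b 1 \<in> horizontal_line e \<longleftrightarrow> b = e"
proof
  assume "proj_point a b 1 \<in> horizontal_line e"
  then obtain x z where "proj_point a b 1 = proj_point x (e * z) z" "(x, e * z, z) \<noteq> (0, 0, 0)"
    by (auto simp: horizontal_line_def)
  moreover have "(a, b, 1) \<in> proj_point a b 1"
    unfolding proj_point_def by (intro CollectI exI[of _ 1]) simp
  ultimately obtain s where "b = s * (e * z)" "1 = s * z" by (auto simp: proj_point_def)
  then show "b = e" by (metis mult.commute mult.left_commute mult_1_right)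
next
  assume "b = e"
  then show "proj_point a b 1 \<in> horizontal_line e"
    unfolding horizontal_line_def
    by (intro CollectI exI[of _ a] exI[of _ b] exI[of _ 1] conjI refl) simp_all
qed

lemma Q_infty_at_infinity: "Q_infty \<iota> X Y \<in> at_infinity"
proof -
  obtain Q where Q: "Q \<in> at_infinity" using ex_at_infinity by blast
  have "Q_infty \<iota> X Y = Q"
    unfolding Q_infty_def
  proof (rule the_equality)
    show "Q \<in> rational_points \<iota> \<and> normalization_map \<iota> X Y Q = proj_point 1 0 0"
      using at_infinity_rational normalization_map_at_infinity Q by blast
    fix P assume P: "P \<in> rational_points \<iota> \<and> normalization_map \<iota> X Y P = proj_point 1 0 0"
    then have "P \<in> rational_points \<iota>" by blast
    then show "P = Q"
    proof (cases rule: rational_place_cases)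
      case 1
      then show ?thesis using at_infinity_unique Q by blast
    next
      case (2 a b)
      then show ?thesis
        using P normalization_map_centered proj_point_affine_neq_infinity by metis
    qed
  qed
  then show ?thesis using Q by simp
qed

section \<open>Coordinates of the evaluation points\<close>

abbreviation "I \<equiv> eval_points \<iota> X Y"

definition xc :: "'f set \<Rightarrow> 'k" where "xc P = value_at \<iota> P X"
definition yc :: "'f set \<Rightarrow> 'k" where "yc P = value_at \<iota> P Y"

lemma coords_centered: "P \<in> centered a b \<Longrightarrow> xc P = a \<and> yc P = b"
  unfolding xc_def yc_def centered_def by (auto intro: value_at_eqI)

lemma eval_points_iff: "P \<in> I \<longleftrightarrow> (\<exists>a b. P \<in> centered a b)"
proof
  assume P: "P \<in> I"
  then have "P \<in> rational_points \<iota>" "P \<noteq> Q_infty \<iota> X Y" by (auto simp: eval_points_def)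
  then show "\<exists>a b. P \<in> centered a b"
    using at_infinity_unique Q_infty_at_infinity by (auto elim!: rational_place_cases)
next
  assume "\<exists>a b. P \<in> centered a b"
  then obtain a b where P: "P \<in> centered a b" by blast
  then have "P \<in> rational_points \<iota>"
    using centered_rational[OF centered_nonempty_imp_on_curve] by blast
  moreover have "X \<in> P"
    using P residue_in_place unfolding centered_def by blast
  then have "P \<noteq> Q_infty \<iota> X Y" using at_infinityD(2)[OF Q_infty_at_infinity] by blast
  ultimately show "P \<in> I" by (simp add: eval_points_def)
qed

lemma eval_point_centered: "P \<in> I \<Longrightarrow> P \<in> centered (xc P) (yc P)"
  using coords_centered eval_points_iff by metis

lemma coords_on_curve: "P \<in> I \<Longrightarrow> yc P ^ q + yc P = xc P ^ m"
  using eval_point_centered centered_nonempty_imp_on_curve by blast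

lemma coords_inj: "P \<in> I \<Longrightarrow> Q \<in> I \<Longrightarrow> xc P = xc Q \<Longrightarrow> yc P = yc Q \<Longrightarrow> P = Q"
  using centered_unique[OF coords_on_curve] eval_point_centered by metis

lemma ex_eval_point:
  assumes "b ^ q + b = a ^ m"
  obtains P where "P \<in> I" "xc P = a" "yc P = b"
  using ex_centered[OF assms] eval_points_iff coords_centered by blast

lemma finite_eval_points: "finite I"
proof (rule finite_imageD)
  show "inj_on (\<lambda>P. (xc P, yc P)) I"
    unfolding inj_on_def prod.inject using coords_inj by blast
qed (rule finite)

lemma value_at_ev: "P \<in> I \<Longrightarrow> value_at \<iota> P (ev p) = evalk (xc P) (yc P) p"
  using eval_point_centered[of P] unfolding centered_def
  by (auto intro: value_at_eqI residue_eval2)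

lemma normalization_map_eq: "P \<in> I \<Longrightarrow> normalization_map \<iota> X Y P = proj_point (xc P) (yc P) 1"
  using eval_point_centered normalization_map_centered by blast

lemma normalization_map_inj: "inj_on (normalization_map \<iota> X Y) I"
proof (rule inj_onI)
  fix P Q assume "P \<in> I" "Q \<in> I" "normalization_map \<iota> X Y P = normalization_map \<iota> X Y Q"
  then show "P = Q"
    using coords_inj by (simp add: normalization_map_eq proj_point_affine_eq_iff)
qed

text \<open>The points correspond to the solutions of \<open>x^m = b^q + b\<close>. The right-hand
  side is a trace, so \<open>card_power_fiber\<close> applies unless it is 0, and then
  \<open>x = 0\<close> is the only solution.\<close>

lemma card_horizontal_points:
  "card {P \<in> I. yc P = b} = (if b ^ q + b = 0 then 1 else m)"
proof -
  have "bij_betw xc {P \<in> I. yc P = b} {a. a ^ m = b ^ q + b}"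
  proof (rule bij_betwI')
    show "(xc P = xc Q) = (P = Q)" if "P \<in> {P \<in> I. yc P = b}" "Q \<in> {P \<in> I. yc P = b}" for P Q
    proof
      assume "xc P = xc Q"
      then show "P = Q" by (rule coords_inj[rotated 2]) (use that in simp_all)
    qed simp
    show "xc P \<in> {a. a ^ m = b ^ q + b}" if "P \<in> {P \<in> I. yc P = b}" for P
      using that coords_on_curve[of P] by simp
    show "\<exists>P\<in>{P \<in> I. yc P = b}. a = xc P" if "a \<in> {a. a ^ m = b ^ q + b}" for a
    proof -
      have "b ^ q + b = a ^ m" using that by simp
      then obtain P where "P \<in> I" "xc P = a" "yc P = b" by (rule ex_eval_point)
      then show ?thesis by blast
    qed
  qed
  then have "card {P \<in> I. yc P = b} = card {a. a ^ m = b ^ q + b}" by (rule bij_betw_same_card)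
  also have "\<dots> = (if b ^ q + b = 0 then 1 else m)"
  proof (cases "b ^ q + b = 0")
    case True
    have "{a :: 'k. a ^ m = b ^ q + b} = {0}" unfolding True using m_ge by (auto simp: power_0_left)
    then show ?thesis using True by simp
  next
    case False
    have "(b ^ q + b) ^ q = (b ^ q) ^ q + b ^ q" by (rule frobenius_add) simp
    also have "(b ^ q) ^ q = b" using power_q_q[of b] by (simp add: power2_eq_square flip: power_mult)
    finally have "(b ^ q + b) ^ q = b ^ q + b" by (simp only: add.commute)
    then show ?thesis using card_power_fiber False by simp
  qed
  finally show ?thesis .
qed

text \<open>Counts the horizontal lines that carry \<open>m\<close> evaluation points.\<close>

lemma card_nonzero_trace: "card {b :: 'k. b ^ q + b \<noteq> 0} = q * (q - 1)"
proof -
  have "card {b :: 'k. b ^ q + b = 0} = q" using card_trace_fiber[of 0] q_ge by (simp add: power_0_left)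
  moreover have "{b :: 'k. b ^ q + b \<noteq> 0} = UNIV - {b. b ^ q + b = 0}" by auto
  ultimately have "card {b :: 'k. b ^ q + b \<noteq> 0} = q\<^sup>2 - q"
    by (simp add: card_Diff_subset card_k)
  then show ?thesis by (simp add: power2_eq_square algebra_simps)
qed

end

section \<open>The dual code\<close>

text \<open>The sum is the coefficient of degree \<open>card A - 1\<close> in the Lagrange
  interpolation polynomial \<open>L\<close> of \<open>e\<close> at the nodes \<open>A\<close>.
  Interpolation is exact here, and \<open>e\<close> has smaller degree.\<close>

lemma divided_difference_eq_0:
  fixes e :: "'a::field poly"
  assumes A: "finite A" and deg: "degree e + 2 \<le> card A"
  shows "(\<Sum>a\<in>A. poly e a / (\<Prod>b\<in>A - {a}. a - b)) = 0"
proof -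
  define w where "w a = poly e a / (\<Prod>b\<in>A - {a}. a - b)" for a
  define B where "B a = (\<Prod>b\<in>A - {a}. [:- b, 1:])" for a
  define L where "L = (\<Sum>a\<in>A. smult (w a) (B a))"
  have deg_B: "degree (B a) = card A - 1" if "a \<in> A" for a
    unfolding B_def using that A by (subst degree_prod_eq_sum_degree) auto
  have coeff_B: "coeff (B a) (card A - 1) = 1" if "a \<in> A" for a
  proof -
    have "lead_coeff (B a) = 1" unfolding B_def lead_coeff_prod by simp
    then show ?thesis by (simp add: deg_B[OF that])
  qed
  have "degree (smult (w a) (B a)) \<le> card A - 1" if "a \<in> A" for a
    using degree_smult_le[of "w a" "B a"] deg_B[OF that] by simp
  then have "degree L \<le> card A - 1" unfolding L_def using A by (intro degree_sum_le) auto
  then have deg_L: "degree L < card A" using deg by linarith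
  have "poly L a = poly e a" if a: "a \<in> A" for a
  proof -
    have "poly (B b) a = 0" if "b \<in> A - {a}" for b
      unfolding B_def poly_prod using A a that by (subst prod_zero_iff) auto
    then have "poly L a = w a * poly (B a) a"
      unfolding L_def poly_sum using A a by (subst sum.remove[OF A a]) auto
    also have "poly (B a) a = (\<Prod>b\<in>A - {a}. a - b)" by (simp add: B_def poly_prod)
    also have "w a * \<dots> = poly e a"
    proof -
      have "(\<Prod>b\<in>A - {a}. a - b) \<noteq> 0" using A by (subst prod_zero_iff) auto
      then show ?thesis by (simp add: w_def)
    qed
    finally show ?thesis .
  qed
  then have "L = e" by (rule poly_eqI_degree) (use deg_L deg in auto)
  then have "coeff L (card A - 1) = 0" using deg by (simp add: coeff_eq_0)
  moreover have "coeff L (card A - 1) = (\<Sum>a\<in>A. w a)"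
    unfolding L_def coeff_sum coeff_smult
    by (rule sum.cong) (simp_all only: coeff_B mult_1_right)
  ultimately show ?thesis by (simp add: w_def)
qed

locale maximal_curve_code = maximal_curve \<iota> X Y q m c
  for \<iota> :: "'k::{field,finite} \<Rightarrow> 'f::field" and X Y :: 'f and q m c :: nat +
  fixes d :: nat
  assumes d_pos: "d > 0" and d_le: "d + 2 \<le> m"
begin

abbreviation "D \<equiv> dual_code I (complete_code \<iota> X Y d)"

lemma dual_code_iff:
  "w \<in> D \<longleftrightarrow> (\<forall>P. P \<notin> I \<longrightarrow> w P = 0) \<and>
    (\<forall>f\<in>global_sections \<iota> X Y d. (\<Sum>P\<in>I. value_at \<iota> P f * w P) = 0)"
proof -
  have "(\<Sum>P\<in>I. (if P \<in> I then value_at \<iota> P f else 0) * w P) = (\<Sum>P\<in>I. value_at \<iota> P f * w P)" for f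
    by (rule sum.cong) auto
  then show ?thesis unfolding dual_code_def complete_code_def by auto
qed

lemma dual_code_support: "w \<in> D \<Longrightarrow> support w \<subseteq> I"
  unfolding dual_code_iff support_def by blast

lemma finite_support: "w \<in> D \<Longrightarrow> finite (support w)"
  using dual_code_support finite_eval_points finite_subset by blast

lemma dual_code_combination:
  assumes "w \<in> D" "w' \<in> D"
  shows "(\<lambda>P. w P - s * w' P) \<in> D"
  unfolding dual_code_iff
proof (intro conjI ballI allI impI)
  fix f assume "f \<in> global_sections \<iota> X Y d"
  then have 0: "(\<Sum>P\<in>I. value_at \<iota> P f * w P) = 0" "(\<Sum>P\<in>I. value_at \<iota> P f * w' P) = 0"
    using assms unfolding dual_code_iff by blast+
  have "(\<Sum>P\<in>I. value_at \<iota> P f * (w P - s * w' P)) =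
      (\<Sum>P\<in>I. value_at \<iota> P f * w P) - s * (\<Sum>P\<in>I. value_at \<iota> P f * w' P)"
    by (simp add: sum_subtractf sum_distrib_left algebra_simps)
  then show "(\<Sum>P\<in>I. value_at \<iota> P f * (w P - s * w' P)) = 0" using 0 by simp
qed (use assms in \<open>auto simp: dual_code_iff\<close>)

lemma zero_in_dual_code: "(\<lambda>_. 0) \<in> D"
  unfolding dual_code_iff by simp

lemma dual_code_scale:
  assumes "w \<in> D"
  shows "(\<lambda>P. s * w P) \<in> D"
  using dual_code_combination[OF zero_in_dual_code assms, of "- s"] by simp

text \<open>When \<open>w\<close> is paired with a section that vanishes at all other points of the
  support, only the term at \<open>P0\<close> remains.\<close>

lemma support_not_separated:
  assumes w: "w \<in> D" and P0: "P0 \<in> support w" and p: "ev p \<in> global_sections \<iota> X Y d"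
    and zero: "\<And>P. P \<in> support w - {P0} \<Longrightarrow> evalk (xc P) (yc P) p = 0"
  shows "evalk (xc P0) (yc P0) p = 0"
proof -
  have P0I: "P0 \<in> I" using dual_code_support[OF w] P0 by blast
  have "0 = (\<Sum>P\<in>I. value_at \<iota> P (ev p) * w P)" using w p unfolding dual_code_iff by simp
  also have "\<dots> = value_at \<iota> P0 (ev p) * w P0 + (\<Sum>P\<in>I - {P0}. value_at \<iota> P (ev p) * w P)"
    by (rule sum.remove[OF finite_eval_points P0I])
  also have "(\<Sum>P\<in>I - {P0}. value_at \<iota> P (ev p) * w P) = 0"
  proof (rule sum.neutral, rule ballI)
    fix P assume P: "P \<in> I - {P0}"
    then show "value_at \<iota> P (ev p) * w P = 0"
      using zero[of P] value_at_ev[of P p] by (cases "P \<in> support w") (auto simp: support_def)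
  qed
  finally show ?thesis using P0 value_at_ev[OF P0I] by (simp add: support_def)
qed

text \<open>Each point of \<open>T\<close> costs one linear factor: \<open>X - a\<close> if its
  \<open>x\<close>-coordinate differs from that of \<open>P0\<close>, and otherwise
  \<open>Y - b\<close>.\<close>

lemma separating_product:
  assumes "finite T" "T \<subseteq> I" "P0 \<in> I" "P0 \<notin> T"
  shows "\<exists>p. ev p \<in> global_sections \<iota> X Y (card T) \<and> (\<forall>P\<in>T. evalk (xc P) (yc P) p = 0) \<and>
    evalk (xc P0) (yc P0) p \<noteq> 0"
  using assms
proof (induction T rule: finite_induct)
  case empty
  then show ?case using one_global_section[of 0] by (intro exI[of _ 1]) simp
next
  case (insert Q T)
  then obtain p where p: "ev p \<in> global_sections \<iota> X Y (card T)"
    "\<forall>P\<in>T. evalk (xc P) (yc P) p = 0" "evalk (xc P0) (yc P0) p \<noteq> 0" by auto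
  have "\<exists>l. ev l \<in> global_sections \<iota> X Y 1 \<and> evalk (xc Q) (yc Q) l = 0 \<and> evalk (xc P0) (yc P0) l \<noteq> 0"
  proof (cases "xc P0 = xc Q")
    case False
    then show ?thesis
      using linear_global_sections(1)[of "xc Q"] by (intro exI[of _ "[:[:- xc Q, 1:]:]"]) simp
  next
    case True
    then have "yc P0 \<noteq> yc Q" using coords_inj[of P0 Q] insert by auto
    then show ?thesis
      using linear_global_sections(2)[of "yc Q"] by (intro exI[of _ "[:[:- yc Q:], 1:]"]) simp
  qed
  then obtain l where "ev l \<in> global_sections \<iota> X Y 1" "evalk (xc Q) (yc Q) l = 0"
    "evalk (xc P0) (yc P0) l \<noteq> 0" by blast
  then show ?case
    using p insert.hyps global_sections_mult[OF p(1), of "ev l" 1]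
    by (intro exI[of _ "p * l"]) auto
qed

text \<open>As \<open>(Y - b)(Y - b')\<close> has pole order \<open>2m \<le> q\<close> at infinity, a single factor suffices to separate
  a point from two others off the horizontal line through it.\<close>

lemma small_support:
  assumes w: "w \<in> D" "w \<noteq> (\<lambda>_. 0)" and card: "card (support w) \<le> d + 2"
  shows "card (support w) = d + 2" "\<exists>b. \<forall>P\<in>support w. yc P = b"
proof -
  let ?S = "support w"
  note fin = finite_support[OF w(1)]
  note SI = dual_code_support[OF w(1)]
  obtain P0 where P0: "P0 \<in> ?S" using w(2) unfolding support_def by blast
  show card_eq: "card ?S = d + 2"
  proof (rule ccontr)
    assume "card ?S \<noteq> d + 2"
    then have le: "card (?S - {P0}) \<le> d" using P0 fin card by simp
    have "finite (?S - {P0})" "?S - {P0} \<subseteq> I" "P0 \<in> I" "P0 \<notin> ?S - {P0}"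
      using fin SI P0 by auto
    from separating_product[OF this] obtain p where
      p: "ev p \<in> global_sections \<iota> X Y (card (?S - {P0}))"
      "\<forall>P\<in>?S - {P0}. evalk (xc P) (yc P) p = 0" "evalk (xc P0) (yc P0) p \<noteq> 0" by blast
    \<comment> \<open>The constant 1 is a section of every degree and fills the degree up to
      \<open>d\<close>.\<close>
    have "ev p \<in> global_sections \<iota> X Y d"
      using global_sections_mult[OF p(1) one_global_section, of "d - card (?S - {P0})"] le by simp
    then show False using support_not_separated[OF w(1) P0] p(2,3) by blast
  qed
  show "\<exists>b. \<forall>P\<in>?S. yc P = b"
  proof (rule ccontr)
    assume "\<not> ?thesis"
    then obtain A B where AB: "A \<in> ?S" "B \<in> ?S" "yc A \<noteq> yc B" using P0 by metis
    then have "A \<noteq> B" by blast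
    then have "card {A, B} = 2" by simp
    \<comment> \<open>As \<open>d > 0\<close>, there is a third point \<open>C\<close>. If it is on
      the line of \<open>A\<close>, then \<open>A\<close> and \<open>C\<close> are off the line of
      \<open>B\<close>; otherwise \<open>B\<close> and \<open>C\<close> are off the line of
      \<open>A\<close>.\<close>
    then have "card (?S - {A, B}) > 0" using AB fin card_eq d_pos by (subst card_Diff_subset) auto
    then obtain C where C: "C \<in> ?S" "C \<noteq> A" "C \<noteq> B" by (auto simp: card_gt_0_iff)
    obtain R Q Q' where R: "R \<in> ?S" "Q \<in> ?S" "Q' \<in> ?S" "Q \<noteq> Q'" "yc Q \<noteq> yc R" "yc Q' \<noteq> yc R"
    proof (cases "yc C = yc A")
      case True
      then show ?thesis using that[of B A C] AB C by metis
    next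
      case False
      then show ?thesis using that[of A B C] AB C by metis
    qed
    \<comment> \<open>The other \<open>d - 1\<close> points get one linear factor each, while
      \<open>Q\<close> and \<open>Q'\<close> share one section of degree 1; the total degree is
      \<open>d\<close>.\<close>
    let ?T = "?S - {R, Q, Q'}"
    have "R \<noteq> Q" "R \<noteq> Q'" using R(5,6) by blast+
    then have "card {R, Q, Q'} = 3" using R(4) by simp
    then have card_T: "card ?T = d - 1"
      using R fin card_eq by (subst card_Diff_subset) auto
    have "finite ?T" "?T \<subseteq> I" "R \<in> I" "R \<notin> ?T" using fin SI R by auto
    from separating_product[OF this] obtain p where
      p: "ev p \<in> global_sections \<iota> X Y (d - 1)"
      "\<forall>P\<in>?T. evalk (xc P) (yc P) p = 0" "evalk (xc R) (yc R) p \<noteq> 0" unfolding card_T by blast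
    let ?l = "[:[:- yc Q:], 1:] * [:[:- yc Q':], 1:]"
    have "ev ?l = (Y - \<iota> (yc Q)) * (Y - \<iota> (yc Q'))"
      unfolding eval2_simps(6) by simp
    then have "ev ?l \<in> global_sections \<iota> X Y 1" using linear_global_sections(3) by simp
    then have "ev (p * ?l) \<in> global_sections \<iota> X Y d"
      using global_sections_mult[OF p(1), of "ev ?l" 1] d_pos by (simp only: eval2_simps(6)) simp
    moreover have l: "evalk (xc P) (yc P) ?l = (yc P - yc Q) * (yc P - yc Q')" for P
      unfolding evalk_simps(6) by simp
    have "evalk (xc P) (yc P) (p * ?l) = 0" if "P \<in> ?S - {R}" for P
      unfolding evalk_simps(6)[of _ _ p] l using that p(2) by (cases "P \<in> ?T") auto
    ultimately have "evalk (xc R) (yc R) (p * ?l) = 0"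
      by (rule support_not_separated[OF w(1) R(1)])
    then show False unfolding evalk_simps(6)[of _ _ p] l using R p(3) by simp
  qed
qed

section \<open>Codewords supported on horizontal lines\<close>

definition horizontal_sets :: "'f set set set" where
  "horizontal_sets = {T. T \<subseteq> I \<and> card T = d + 2 \<and> (\<exists>b. \<forall>P\<in>T. yc P = b)}"

lemma ex_codeword_with_support:
  assumes "T \<in> horizontal_sets"
  obtains w where "w \<in> D" "support w = T"
proof -
  obtain b where T: "T \<subseteq> I" "card T = d + 2" "\<And>P. P \<in> T \<Longrightarrow> yc P = b"
    using assms by (auto simp: horizontal_sets_def)
  have fin: "finite T" using T(1) finite_eval_points finite_subset by blast
  have inj: "inj_on xc T"
  proof (rule inj_onI)
    fix P Q assume "P \<in> T" "Q \<in> T" "xc P = xc Q"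
    then show "P = Q" using coords_inj[of P Q] T by auto
  qed
  define w where "w P = (if P \<in> T then 1 / (\<Prod>Q\<in>T - {P}. xc P - xc Q) else 0)" for P
  have "(\<Prod>Q\<in>T - {P}. xc P - xc Q) \<noteq> 0" if "P \<in> T" for P
    using fin inj_onD[OF inj] that by (subst prod_zero_iff) auto
  then have "support w = T" by (auto simp: support_def w_def)
  moreover have "w \<in> D"
    unfolding dual_code_iff
  proof (intro conjI ballI allI impI)
    show "w P = 0" if "P \<notin> I" for P using that T by (auto simp: w_def)
    fix f assume "f \<in> global_sections \<iota> X Y d"
    from global_section_polynomial[OF this] obtain p where
      p: "f = ev p" "\<And>i j. coeff (coeff p j) i \<noteq> 0 \<Longrightarrow> q * i + m * j \<le> q * d" by metis
    define e where "e = poly p [:b:]"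
    \<comment> \<open>The weight bound forces \<open>i \<le> d\<close> whatever \<open>j\<close> is,
      so setting \<open>y = b\<close> leaves degree at most \<open>d\<close> in
      \<open>x\<close>.\<close>
    have deg_coeff: "degree (coeff p j) \<le> d" for j
    proof (rule degree_le, intro allI impI)
      fix i assume "d < i"
      then have "q * d < q * i" using q_ge by simp
      then have "\<not> q * i + m * j \<le> q * d" by linarith
      then show "coeff (coeff p j) i = 0" using p(2) by blast
    qed
    have "degree (coeff p j * [:b:] ^ j) \<le> d" for j
      using degree_smult_le[of "b ^ j" "coeff p j"] deg_coeff[of j] by (simp add: poly_const_pow mult.commute)
    then have deg: "degree e \<le> d"
      unfolding e_def poly_altdef by (intro degree_sum_le) auto
    have val: "value_at \<iota> P f = poly e (xc P)" if "P \<in> T" for P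
      using value_at_ev[of P p] T that by (auto simp: p(1) evalk_eq e_def)
    have "(\<Sum>P\<in>I. value_at \<iota> P f * w P) = (\<Sum>P\<in>T. value_at \<iota> P f * w P)"
      using T(1) finite_eval_points by (intro sum.mono_neutral_right) (auto simp: w_def)
    also have "\<dots> = (\<Sum>P\<in>T. poly e (xc P) / (\<Prod>a\<in>xc ` T - {xc P}. xc P - a))"
    proof (rule sum.cong[OF refl])
      fix P assume P: "P \<in> T"
      have "xc ` T - {xc P} = xc ` (T - {P})" using inj P by (auto simp: inj_on_def)
      moreover have "inj_on xc (T - {P})" using inj by (rule inj_on_subset) auto
      ultimately have "(\<Prod>a\<in>xc ` T - {xc P}. xc P - a) = (\<Prod>Q\<in>T - {P}. xc P - xc Q)"
        by (simp add: prod.reindex)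
      then show "value_at \<iota> P f * w P = poly e (xc P) / (\<Prod>a\<in>xc ` T - {xc P}. xc P - a)"
        using P val by (simp add: w_def)
    qed
    also have "\<dots> = (\<Sum>a\<in>xc ` T. poly e a / (\<Prod>a'\<in>xc ` T - {a}. a - a'))"
      using inj by (simp add: sum.reindex)
    also have "\<dots> = 0"
      by (rule divided_difference_eq_0) (use fin deg in \<open>auto simp: card_image[OF inj] T(2)\<close>)
    finally show "(\<Sum>P\<in>I. value_at \<iota> P f * w P) = 0" .
  qed
  ultimately show ?thesis using that by blast
qed

lemma support_eq_empty_iff: "support w = {} \<longleftrightarrow> w = (\<lambda>_. 0)"
  unfolding support_def by auto

lemma support_card_ge:
  assumes "w \<in> D" "w \<noteq> (\<lambda>_. 0)"
  shows "d + 2 \<le> card (support w)"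
  using small_support(1)[OF assms] by linarith

text \<open>Given two codewords with support \<open>T\<close>, a multiple of one can be subtracted
  from the other to cancel the entry at \<open>P0\<close>. The difference has weight less than
  \<open>d + 2\<close>, so it is zero, and the codewords are the nonzero multiples of one of
  them.\<close>

lemma card_codewords_with_support:
  assumes T: "T \<in> horizontal_sets"
  shows "card {w \<in> D. support w = T} = q\<^sup>2 - 1" "finite {w \<in> D. support w = T}"
proof -
  obtain w0 where w0: "w0 \<in> D" "support w0 = T" using ex_codeword_with_support[OF T] .
  have card_T: "card T = d + 2" using T by (simp add: horizontal_sets_def)
  then obtain P0 where P0: "P0 \<in> T" by fastforce
  then have nz: "w0 P0 \<noteq> 0" using w0 by (auto simp: support_def)
  have fin: "finite T" using finite_support w0 by blast
  have "{w \<in> D. support w = T} = (\<lambda>s P. s * w0 P) ` (UNIV - {0})"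
  proof (intro equalityI subsetI)
    fix w assume "w \<in> {w \<in> D. support w = T}"
    then have w: "w \<in> D" "support w = T" by auto
    define s where "s = w P0 / w0 P0"
    have "w P0 \<noteq> 0" using P0 w by (auto simp: support_def)
    then have s: "s \<noteq> 0" using nz by (simp add: s_def)
    let ?v = "\<lambda>P. w P - s * w0 P"
    have v: "?v \<in> D" by (rule dual_code_combination[OF w(1) w0(1)])
    have "w P = 0 \<and> w0 P = 0" if "P \<notin> T" for P
      using that w(2) w0(2) unfolding support_def by blast
    then have "?v P = 0" if "P \<notin> T - {P0}" for P
      using that nz by (cases "P = P0") (simp_all add: s_def)
    then have "support ?v \<subseteq> T - {P0}" unfolding support_def by blast
    then have "card (support ?v) \<le> card (T - {P0})" using fin by (intro card_mono) auto
    also have "\<dots> < d + 2" using card_T P0 fin by simp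
    finally have "?v = (\<lambda>_. 0)" using support_card_ge[OF v] by (metis not_le)
    then have "w P = s * w0 P" for P by (metis eq_iff_diff_eq_0)
    then show "w \<in> (\<lambda>s P. s * w0 P) ` (UNIV - {0})" using s by blast
  next
    fix w assume "w \<in> (\<lambda>s P. s * w0 P) ` (UNIV - {0})"
    then show "w \<in> {w \<in> D. support w = T}"
      using dual_code_scale[OF w0(1)] w0(2) by (auto simp: support_def)
  qed
  moreover have "inj_on (\<lambda>s P. s * w0 P) (UNIV - {0})"
    by (rule inj_onI) (metis nz mult_right_cancel)
  ultimately show "card {w \<in> D. support w = T} = q\<^sup>2 - 1" "finite {w \<in> D. support w = T}"
    by (simp_all add: card_image card_Diff_singleton card_k)
qed

text \<open>A line with \<open>b^q + b = 0\<close> has a single evaluation point and thus no subset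
  of size \<open>d + 2\<close>. Sets from different lines are distinct because they are
  nonempty.\<close>

lemma card_horizontal_sets: "card horizontal_sets = q * (q - 1) * (m choose (d + 2))"
  and horizontal_sets_nonempty: "horizontal_sets \<noteq> {}"
proof -
  define H where "H b = {T. T \<subseteq> {P \<in> I. yc P = b} \<and> card T = d + 2}" for b
  have fin: "finite {P \<in> I. yc P = b}" for b using finite_eval_points by simp
  have card_H: "card (H b) = (if b ^ q + b = 0 then 0 else m choose (d + 2))" for b
    unfolding H_def n_subsets[OF fin] card_horizontal_points by simp
  have finite_H: "finite (H b)" for b unfolding H_def using fin by simp
  have eq: "horizontal_sets = (\<Union>b. H b)" unfolding H_def horizontal_sets_def by blast
  have "card (\<Union>b. H b) = (\<Sum>b\<in>UNIV. card (H b))"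
  proof (rule card_UN_disjoint)
    show "\<forall>b\<in>UNIV. \<forall>b'\<in>UNIV. b \<noteq> b' \<longrightarrow> H b \<inter> H b' = {}"
    proof (intro ballI impI)
      fix b b' :: 'k assume "b \<noteq> b'"
      have "T = {}" if "T \<in> H b" "T \<in> H b'" for T using that \<open>b \<noteq> b'\<close> by (auto simp: H_def)
      moreover have "{} \<notin> H b" by (simp add: H_def)
      ultimately show "H b \<inter> H b' = {}" by blast
    qed
  qed (use finite_H in auto)
  also have "\<dots> = (\<Sum>b :: 'k | b ^ q + b \<noteq> 0. m choose (d + 2))"
    unfolding card_H by (simp add: sum.If_cases Collect_neg_eq)
  also have "\<dots> = q * (q - 1) * (m choose (d + 2))" by (simp add: card_nonzero_trace)
  finally show card: "card horizontal_sets = q * (q - 1) * (m choose (d + 2))" unfolding eq .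
  have "m choose (d + 2) > 0" using d_le by simp
  then have "card horizontal_sets \<noteq> 0" unfolding card using q_ge by simp
  then show "horizontal_sets \<noteq> {}" by auto
qed

section \<open>Minimum weight and minimum distance\<close>

lemma minimum_weight_codewords_eq:
  "minimum_weight_codewords D = {w \<in> D. support w \<in> horizontal_sets}"
proof -
  obtain T where T: "T \<in> horizontal_sets" using horizontal_sets_nonempty by blast
  obtain w0 where w0: "w0 \<in> D" "support w0 = T" using ex_codeword_with_support[OF T] .
  have card_T: "card T = d + 2" using T by (simp add: horizontal_sets_def)
  then have "w0 \<noteq> (\<lambda>_. 0)" using w0 support_eq_empty_iff[of w0] by auto
  show ?thesis
  proof (intro equalityI subsetI)
    fix w assume "w \<in> minimum_weight_codewords D"
    then have w: "w \<in> D" "w \<noteq> (\<lambda>_. 0)" "card (support w) \<le> card (support w0)"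
      using w0(1) \<open>w0 \<noteq> _\<close> by (auto simp: minimum_weight_codewords_def)
    then have "card (support w) \<le> d + 2" using w0 card_T by simp
    from small_support[OF w(1,2) this] show "w \<in> {w \<in> D. support w \<in> horizontal_sets}"
      using w(1) dual_code_support[OF w(1)] by (simp add: horizontal_sets_def)
  next
    fix w assume "w \<in> {w \<in> D. support w \<in> horizontal_sets}"
    then have w: "w \<in> D" "card (support w) = d + 2" by (auto simp: horizontal_sets_def)
    then have "w \<noteq> (\<lambda>_. 0)" using support_eq_empty_iff[of w] by auto
    then show "w \<in> minimum_weight_codewords D"
      using w support_card_ge by (simp add: minimum_weight_codewords_def)
  qed
qed

lemma card_minimum_weight_codewords:
  "card (minimum_weight_codewords D) = q * (q - 1) * (q\<^sup>2 - 1) * (m choose (d + 2))"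
proof -
  have "finite horizontal_sets"
    by (rule finite_subset[of _ "Pow I"]) (auto simp: horizontal_sets_def finite_eval_points)
  have "minimum_weight_codewords D = (\<Union>T\<in>horizontal_sets. {w \<in> D. support w = T})"
    unfolding minimum_weight_codewords_eq by blast
  also have "card \<dots> = (\<Sum>T\<in>horizontal_sets. card {w \<in> D. support w = T})"
    by (rule card_UN_disjoint) (use \<open>finite horizontal_sets\<close> card_codewords_with_support(2) in auto)
  also have "\<dots> = (\<Sum>T\<in>horizontal_sets. q\<^sup>2 - 1)"
    by (rule sum.cong) (auto simp: card_codewords_with_support)
  also have "\<dots> = q * (q - 1) * (q\<^sup>2 - 1) * (m choose (d + 2))"
    by (simp add: card_horizontal_sets)
  finally show ?thesis .
qed

lemma minimum_distance_dual_code: "minimum_distance D = d + 2"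
proof -
  obtain T where T: "T \<in> horizontal_sets" using horizontal_sets_nonempty by blast
  obtain w0 where w0: "w0 \<in> D" "support w0 = T" using ex_codeword_with_support[OF T] .
  have card_T: "card T = d + 2" using T by (simp add: horizontal_sets_def)
  then have nz: "w0 \<noteq> (\<lambda>_. 0)" using w0 support_eq_empty_iff[of w0] by auto
  let ?H = "{hamming_distance v w | v w. v \<in> D \<and> w \<in> D \<and> v \<noteq> w}"
  have "d + 2 \<in> ?H"
  proof -
    have "hamming_distance w0 (\<lambda>_. 0) = d + 2"
      using w0(2) card_T by (simp add: hamming_distance_def support_def)
    then show ?thesis using w0(1) nz zero_in_dual_code by (metis (mono_tags, lifting) mem_Collect_eq)
  qed
  moreover have "d + 2 \<le> n" if "n \<in> ?H" for n
  proof -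
    obtain v w where vw: "n = hamming_distance v w" "v \<in> D" "w \<in> D" "v \<noteq> w"
      using \<open>n \<in> ?H\<close> by blast
    \<comment> \<open>The factor 1 gives the difference the form required by
      \<open>dual_code_combination\<close>.\<close>
    let ?u = "\<lambda>P. v P - 1 * w P"
    have "?u \<in> D" by (rule dual_code_combination[OF vw(2,3)])
    moreover have "?u \<noteq> (\<lambda>_. 0)"
    proof
      assume "?u = (\<lambda>_. 0)"
      then have "v P = w P" for P by (metis eq_iff_diff_eq_0 mult_1)
      then show False using vw(4) by blast
    qed
    ultimately have "d + 2 \<le> card (support ?u)" by (rule support_card_ge)
    also have "support ?u = {P. v P \<noteq> w P}" by (simp add: support_def)
    finally show ?thesis by (simp add: vw(1) hamming_distance_def)
  qed
  ultimately show ?thesis unfolding minimum_distance_def by (intro cInf_eq_minimum) auto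
qed

lemma support_of_minimum_weight_codeword_iff:
  assumes S: "S \<subseteq> I"
  shows "(\<exists>w\<in>minimum_weight_codewords D. support w = S) \<longleftrightarrow>
    card (normalization_map \<iota> X Y ` S) = d + 2 \<and>
    (\<exists>a. normalization_map \<iota> X Y ` S \<subseteq> horizontal_line a)"
proof -
  have "(\<exists>w\<in>minimum_weight_codewords D. support w = S) \<longleftrightarrow> S \<in> horizontal_sets"
    unfolding minimum_weight_codewords_eq using ex_codeword_with_support[of S] by blast
  moreover have "card (normalization_map \<iota> X Y ` S) = card S"
    using normalization_map_inj S by (intro card_image) (rule inj_on_subset)
  moreover have "normalization_map \<iota> X Y ` S \<subseteq> horizontal_line a \<longleftrightarrow> (\<forall>P\<in>S. yc P = a)" for a
  proof -
    have "normalization_map \<iota> X Y P \<in> horizontal_line a \<longleftrightarrow> yc P = a" if "P \<in> S" for P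
    proof -
      have "P \<in> I" using that S by blast
      then show ?thesis by (simp add: normalization_map_eq horizontal_line_affine_iff)
    qed
    then show ?thesis by blast
  qed
  ultimately show ?thesis using S by (simp add: horizontal_sets_def)
qed

end

theorem theorem3:
  fixes q m c d :: nat
    and \<iota> :: "'k::{field,finite} \<Rightarrow> 'f::field"
    and X Y :: 'f
  defines "D \<equiv> dual_code (eval_points \<iota> X Y) (complete_code \<iota> X Y d)"
  assumes "primepow q" and "CARD('k) = q\<^sup>2"
    and "m > 0" and "m dvd q + 1" and "m \<noteq> q + 1"
    and "is_function_field (curve_poly q m) \<iota> X Y"
    and "d > 0" and "d + 2 \<le> m"
    and "c = (q + 1) div m" and "c \<ge> 3"
  shows "minimum_distance D = d + 2 \<and>
    (\<forall>S \<subseteq> eval_points \<iota> X Y.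
       (\<exists>w \<in> minimum_weight_codewords D. support w = S) \<longleftrightarrow>
       card (normalization_map \<iota> X Y ` S) = d + 2 \<and>
       (\<exists>a. normalization_map \<iota> X Y ` S \<subseteq> horizontal_line a)) \<and>
    card (minimum_weight_codewords D) = q * (q - 1) * (q\<^sup>2 - 1) * (m choose (d + 2))"
proof -
  interpret maximal_curve_code \<iota> X Y q m c d
  proof
    show "field_embedding \<iota>" using assms by (simp add: is_function_field_def)
    show "m * c = q + 1" using assms by simp
  qed (use assms in auto)
  show ?thesis
    unfolding D_def
    using minimum_distance_dual_code card_minimum_weight_codewords
      support_of_minimum_weight_codeword_iff by blast
qed

end
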